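(* Let $V=\operatorname{Spec} A$ be a normal affine $\mathbb{C}^*$-surface over $\mathbb{C}$ carrying a $\mathbb{C}_+$-action, with DPD-presentation $A=\mathbb{C}[t][D_+,D_-]\subseteq\mathbb{C}(t)[u,u^{-1}]$, where $$D_+=-\frac{e_+}{d}[0]\ \text{ with }\ 0<e_+\le d,\qquad D_-=-\frac{e_-}{d}[0]-\frac1k D_0,$$ with integers $d,k\ge 1$, $e_+,e_-$, and with $D_0$ an integral divisor on $\mathbb{A}^1=\operatorname{Spec}\mathbb{C}[t]$ such that $D_0(0)=0$. Choose a polynomial $Q\in\mathbb{C}[t]$ with $D_0=\operatorname{div}(Q)$ (so $Q(0)\neq 0$). Let $$F=x^ky-s^{k(e_++e_-)}\,Q(s^d/z)\,z^{\deg Q}\in\mathbb{C}[x,y,z,s],$$ which is weighted homogeneous of degree $k(e_++e_-)+d\deg Q$ with respect to the weights $$\deg x=e_+,\quad \deg y=ke_-+d\deg Q,\quad \deg z=d,\quad \deg s=1 .$$ Then $V$ is equivariantly isomorphic to the normalization of the principal Zariski open subset $\mathbb{D}_+(z)$ of the hypersurface $\mathbb{V}_+(F)$ in the weighted projective $3$-space $\mathbb{P}=\mathbb{P}(e_+,\,ke_-+d\deg Q,\,d,\,1)$.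
   Context: DPD-presentation: let $D_+,D_-$ be $\mathbb{Q}$-divisors on $\mathbb{A}^1=\operatorname{Spec}\mathbb{C}[t]$ with $D_++D_-\le 0$. Then $\mathbb{C}[t][D_+,D_-]=\bigoplus_{i\in\mathbb{Z}}A_i\subseteq\mathbb{C}(t)[u,u^{-1}]$ is the $\mathbb{Z}$-graded subring with, for $i\ge 0$, $$A_i=\{f\in\mathbb{C}(t)\mid \operatorname{div} f+iD_+\ge 0\}\,u^i,\qquad A_{-i}=\{f\in\mathbb{C}(t)\mid\operatorname{div} f+iD_-\ge 0\}\,u^{-i}$$ (with $0$ included in each piece). The $\mathbb{C}^*$-action on $V=\operatorname{Spec} A$ is the one defined by this $\mathbb{Z}$-grading. $D(0)$ denotes the coefficient of a divisor $D$ at the point $0\in\mathbb{A}^1$. The condition $D_++D_-\le 0$ gives $e_++e_-\ge 0$ and $D_0\geq 0$. The open subset $\mathbb{D}_+(z)=\{z\ne 0\}$ of $\mathbb{V}_+(F)=\{F=0\}\subseteq\mathbb{P}$ is $\operatorname{Spec}\,(R[1/z])_0$, where $R=\mathbb{C}[x,y,z,s]/(F)$ carries the grading given by the weights above and $(\cdot)_0$ denotes the degree-$0$ part; if the weight $ke_-+d\deg Q$ is not positive, $\mathbb{D}_+(z)$ is understood as this spectrum. The $\mathbb{C}^*$-action on it is the one induced by $\lambda.(x,y,z,s)=(\lambda x,\lambda^{-k}y,z,s)$. *)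

theory Defs
  imports
    "HOL-Algebra.Algebra"
    "HOL-Algebra.Algebraic_Closure_Type"
    "HOL-Library.Poly_Mapping"
    "HOL-Library.Extended_Nat"
    "HOL-Computational_Algebra.Computational_Algebra"
    "HOL-Computational_Algebra.Field_as_Ring"
begin

section \<open>Algebras with a torus action\<close>

text \<open>
  An affine complex variety with an action of the multiplicative group is represented by its
  coordinate ring: a ring with structure map \<open>scal\<close> from the complex numbers, and, for every
  \<open>l \<noteq> 0\<close>, the algebra automorphism \<open>torus A l\<close>, which is \<open>f \<mapsto> f \<circ> l\<close>. In terms of the
  associated grading, \<open>torus A l\<close> multiplies elements of degree \<open>i\<close> by the \<open>i\<close>-th power of \<open>l\<close>.
\<close>

record 'a gm_algebra = "'a ring" +
  scal :: "complex \<Rightarrow> 'a"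
  torus :: "complex \<Rightarrow> 'a \<Rightarrow> 'a"

text \<open>
  Since \<open>Spec\<close> is an anti-equivalence, two affine varieties are equivariantly isomorphic iff their
  coordinate rings are isomorphic as algebras, compatibly with the torus actions.
\<close>

definition equivariantly_isomorphic :: "'a gm_algebra \<Rightarrow> 'b gm_algebra \<Rightarrow> bool" where
  "equivariantly_isomorphic A B \<longleftrightarrow>
     (\<exists>\<phi> \<in> ring_iso A B.
        (\<forall>c. \<phi> (scal A c) = scal B c) \<and>
        (\<forall>l. l \<noteq> 0 \<longrightarrow> (\<forall>a \<in> carrier A. \<phi> (torus A l a) = torus B l (\<phi> a))))"


section \<open>Localization and normalization\<close>

definition frac :: "('a, 'm) ring_scheme \<Rightarrow> 'a set \<Rightarrow> 'a \<Rightarrow> 'a \<Rightarrow> ('a \<times> 'a) set" where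
  "frac A S a s = {(b, t) \<in> carrier A \<times> S.
     \<exists>u \<in> S. u \<otimes>\<^bsub>A\<^esub> (a \<otimes>\<^bsub>A\<^esub> t) = u \<otimes>\<^bsub>A\<^esub> (b \<otimes>\<^bsub>A\<^esub> s)}"

text \<open>
  The localization at a multiplicative set \<open>S\<close> that is stable under the torus. The operations are
  defined on classes by taking unions over representatives, all of which give the same class.
\<close>

definition localization :: "'a gm_algebra \<Rightarrow> 'a set \<Rightarrow> ('a \<times> 'a) set gm_algebra" where
  "localization A S =
     \<lparr>carrier = {frac A S a s | a s. a \<in> carrier A \<and> s \<in> S},
      monoid.mult = (\<lambda>U V. \<Union>(a, s) \<in> U. \<Union>(b, t) \<in> V. frac A S (a \<otimes>\<^bsub>A\<^esub> b) (s \<otimes>\<^bsub>A\<^esub> t)),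
      one = frac A S \<one>\<^bsub>A\<^esub> \<one>\<^bsub>A\<^esub>,
      ring.zero = frac A S \<zero>\<^bsub>A\<^esub> \<one>\<^bsub>A\<^esub>,
      ring.add = (\<lambda>U V. \<Union>(a, s) \<in> U. \<Union>(b, t) \<in> V.
               frac A S ((a \<otimes>\<^bsub>A\<^esub> t) \<oplus>\<^bsub>A\<^esub> (b \<otimes>\<^bsub>A\<^esub> s)) (s \<otimes>\<^bsub>A\<^esub> t)),
      scal = (\<lambda>c. frac A S (scal A c) \<one>\<^bsub>A\<^esub>),
      torus = (\<lambda>l U. \<Union>(a, s) \<in> U. frac A S (torus A l a) (torus A l s))\<rparr>"

definition non_zero_divisors :: "('a, 'm) ring_scheme \<Rightarrow> 'a set" where
  "non_zero_divisors A =
     {s \<in> carrier A. \<forall>a \<in> carrier A. s \<otimes>\<^bsub>A\<^esub> a = \<zero>\<^bsub>A\<^esub> \<longrightarrow> a = \<zero>\<^bsub>A\<^esub>}"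

text \<open>For a domain this is the field of fractions.\<close>

definition total_fractions :: "'a gm_algebra \<Rightarrow> ('a \<times> 'a) set gm_algebra" where
  "total_fractions A = localization A (non_zero_divisors A)"

definition fractions_image :: "'a gm_algebra \<Rightarrow> ('a \<times> 'a) set set" where
  "fractions_image A = (\<lambda>a. frac A (non_zero_divisors A) a \<one>\<^bsub>A\<^esub>) ` carrier A"

text \<open>Polynomials over \<open>k\<close> are coefficient lists, leading coefficient first.\<close>

definition integral_closure :: "('a, 'm) ring_scheme \<Rightarrow> 'a set \<Rightarrow> 'a set" where
  "integral_closure K k =
     {x \<in> carrier K. \<exists>p \<in> carrier (k[X]\<^bsub>K\<^esub>).
        p \<noteq> [] \<and> hd p = \<one>\<^bsub>K\<^esub> \<and> ring.eval K p x = \<zero>\<^bsub>K\<^esub>}"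

definition normalization :: "'a gm_algebra \<Rightarrow> ('a \<times> 'a) set gm_algebra" where
  "normalization A =
     (total_fractions A)\<lparr>carrier := integral_closure (total_fractions A) (fractions_image A)\<rparr>"


section \<open>Normal affine surfaces and actions of the additive group\<close>

definition krull_dim :: "('a, 'm) ring_scheme \<Rightarrow> enat" where
  "krull_dim A =
     (SUP Ps \<in> {Ps. Ps \<noteq> [] \<and> (\<forall>P \<in> set Ps. primeideal P A) \<and> sorted_wrt (\<subset>) Ps}.
        enat (length Ps - 1))"

definition normal_affine_surface :: "'a gm_algebra \<Rightarrow> bool" where
  "normal_affine_surface A \<longleftrightarrow>
     domain A \<and>
     (\<exists>G. finite G \<and> G \<subseteq> carrier A \<and> carrier A = generate_ring A (range (scal A) \<union> G)) \<and>
     krull_dim A = 2 \<and>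
     integral_closure (total_fractions A) (fractions_image A) = fractions_image A"

text \<open>
  A (nontrivial, algebraic) action of the additive group of complex numbers on \<open>Spec A\<close>,
  given by its effect on \<open>A\<close>: algebra endomorphisms \<open>\<sigma> c\<close>, additive in \<open>c\<close>, such that \<open>\<sigma> c a\<close> is,
  for each \<open>a\<close>, a polynomial in \<open>c\<close> with coefficients in \<open>A\<close>.
\<close>

definition additive_group_action :: "'a gm_algebra \<Rightarrow> (complex \<Rightarrow> 'a \<Rightarrow> 'a) \<Rightarrow> bool" where
  "additive_group_action A \<sigma> \<longleftrightarrow>
     (\<forall>c. \<sigma> c \<in> ring_hom A A \<and> (\<forall>b. \<sigma> c (scal A b) = scal A b)) \<and>
     (\<forall>a \<in> carrier A. \<sigma> 0 a = a) \<and>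
     (\<forall>c c'. \<forall>a \<in> carrier A. \<sigma> (c + c') a = \<sigma> c (\<sigma> c' a)) \<and>
     (\<forall>a \<in> carrier A. \<exists>p \<in> carrier ((carrier A)[X]\<^bsub>A\<^esub>). \<forall>c. \<sigma> c a = ring.eval A p (scal A c)) \<and>
     (\<exists>c. \<exists>a \<in> carrier A. \<sigma> c a \<noteq> a)"


section \<open>Divisors on the affine line and the algebra of a pair of divisors\<close>

definition order_at :: "complex \<Rightarrow> complex poly fract \<Rightarrow> int" where
  "order_at p f = int (Polynomial.order p (fst (quot_of_fract f)))
                - int (Polynomial.order p (snd (quot_of_fract f)))"

text \<open>
  Divisors are finitely supported functions on the closed points of the affine line. The value
  for \<open>f = 0\<close> is a dummy.
\<close>

lift_definition princ_div :: "complex poly fract \<Rightarrow> (complex \<Rightarrow>\<^sub>0 int)" is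
  "\<lambda>f p. order_at p f when f \<noteq> 0"
proof -
  fix f :: "complex poly fract"
  show "finite {p. (order_at p f when f \<noteq> 0) \<noteq> 0}"
  proof (cases "f = 0")
    case False
    define a b where "a = fst (quot_of_fract f)" and "b = snd (quot_of_fract f)"
    have b: "b \<noteq> 0" unfolding b_def by simp
    have f: "f = Fract a b"
      using quot_to_fract_quot_of_fract [of f]
      by (simp add: quot_to_fract_def a_def b_def case_prod_unfold)
    have a: "a \<noteq> 0"
    proof
      assume "a = 0"
      with f False show False by (simp only: fract_collapse)
    qed
    have "(order_at p f when f \<noteq> 0) = 0" if "poly a p \<noteq> 0" "poly b p \<noteq> 0" for p
      using that order_0I [of a p] order_0I [of b p] unfolding order_at_def a_def b_def by simp
    then have "{p. (order_at p f when f \<noteq> 0) \<noteq> 0} \<subseteq> {p. poly a p = 0} \<union> {p. poly b p = 0}"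
      by blast
    moreover have "finite ({p. poly a p = 0} \<union> {p. poly b p = 0})"
      using a b by (simp add: poly_roots_finite)
    ultimately show ?thesis by (rule finite_subset)
  qed simp
qed

definition rat_div :: "(complex \<Rightarrow>\<^sub>0 int) \<Rightarrow> (complex \<Rightarrow>\<^sub>0 rat)" where
  "rat_div D = Poly_Mapping.map of_int D"

definition scale_div :: "rat \<Rightarrow> (complex \<Rightarrow>\<^sub>0 rat) \<Rightarrow> (complex \<Rightarrow>\<^sub>0 rat)" where
  "scale_div r D = Poly_Mapping.map ((*) r) D"

text \<open>The order \<open>\<le>\<close> of the type would be lexicographic, hence a separate predicate.\<close>

definition effective :: "(complex \<Rightarrow>\<^sub>0 rat) \<Rightarrow> bool" where
  "effective D \<longleftrightarrow> (\<forall>p. 0 \<le> Poly_Mapping.lookup D p)"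

definition dpd_piece ::
    "(complex \<Rightarrow>\<^sub>0 rat) \<Rightarrow> (complex \<Rightarrow>\<^sub>0 rat) \<Rightarrow> int \<Rightarrow> complex poly fract set" where
  "dpd_piece Dp Dm i =
     {f. f = 0 \<or> effective (rat_div (princ_div f) +
           (if i \<ge> 0 then scale_div (of_int i) Dp else scale_div (of_int (- i)) Dm))}"

text \<open>
  Laurent polynomials in \<open>u\<close> over the field of rational functions in \<open>t\<close> form the type
  \<open>int \<Rightarrow>\<^sub>0 complex poly fract\<close>; the coefficient of the \<open>i\<close>-th power of \<open>u\<close> is \<open>lookup a i\<close>.
\<close>

definition dpd_algebra ::
    "(complex \<Rightarrow>\<^sub>0 rat) \<Rightarrow> (complex \<Rightarrow>\<^sub>0 rat) \<Rightarrow> (int \<Rightarrow>\<^sub>0 complex poly fract) gm_algebra" where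
  "dpd_algebra Dp Dm =
     ring.extend
       (ring_of_type_algebra\<lparr>carrier := {a. \<forall>i. Poly_Mapping.lookup a i \<in> dpd_piece Dp Dm i}\<rparr>)
       (gm_algebra.fields
          (\<lambda>c. Poly_Mapping.single 0 (to_fract [:c:]))
          (\<lambda>l. Poly_Mapping.mapp (\<lambda>i f. to_fract [:l powi i:] * f)))"


section \<open>The weighted projective hypersurface\<close>

datatype coord = Coord_x | Coord_y | Coord_z | Coord_s

type_synonym poly_xyzs = "(coord \<Rightarrow>\<^sub>0 nat) \<Rightarrow>\<^sub>0 complex"

definition coord_poly :: "coord \<Rightarrow> poly_xyzs" where
  "coord_poly v = Poly_Mapping.single (Poly_Mapping.single v 1) 1"

text \<open>The torus acts on points by \<open>l.(x, y, z, s) = (l x, l\<^sup>-\<^sup>k y, z, s)\<close>.\<close>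

definition xyzs_algebra :: "nat \<Rightarrow> poly_xyzs gm_algebra" where
  "xyzs_algebra k =
     ring.extend ring_of_type_algebra
       (gm_algebra.fields
          (\<lambda>c. Poly_Mapping.single 0 c)
          (\<lambda>l. Poly_Mapping.mapp (\<lambda>m c.
             l powi (int (Poly_Mapping.lookup m Coord_x)
                     - int k * int (Poly_Mapping.lookup m Coord_y)) * c)))"

definition weighted_homogeneous :: "(coord \<Rightarrow> int) \<Rightarrow> int \<Rightarrow> poly_xyzs \<Rightarrow> bool" where
  "weighted_homogeneous w n p \<longleftrightarrow>
     (\<forall>m \<in> Poly_Mapping.keys p.
        (\<Sum>v \<in> {Coord_x, Coord_y, Coord_z, Coord_s}. w v * int (Poly_Mapping.lookup m v)) = n)"

definition quotient_algebra :: "'a gm_algebra \<Rightarrow> 'a set \<Rightarrow> 'a set gm_algebra" where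
  "quotient_algebra A I =
     ring.extend (A Quot I)
       (gm_algebra.fields
          (\<lambda>c. I +>\<^bsub>A\<^esub> scal A c)
          (\<lambda>l U. \<Union>a \<in> U. I +>\<^bsub>A\<^esub> torus A l a))"

definition hypersurface_ring :: "nat \<Rightarrow> poly_xyzs \<Rightarrow> poly_xyzs set gm_algebra" where
  "hypersurface_ring k F = quotient_algebra (xyzs_algebra k) (PIdl\<^bsub>xyzs_algebra k\<^esub> F)"

definition residue_class :: "nat \<Rightarrow> poly_xyzs \<Rightarrow> poly_xyzs \<Rightarrow> poly_xyzs set" where
  "residue_class k F p = (PIdl\<^bsub>xyzs_algebra k\<^esub> F) +>\<^bsub>xyzs_algebra k\<^esub> p"

definition z_powers :: "nat \<Rightarrow> poly_xyzs \<Rightarrow> poly_xyzs set set" where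
  "z_powers k F =
     {residue_class k F (coord_poly Coord_z) [^]\<^bsub>hypersurface_ring k F\<^esub> n | n. n \<in> (UNIV :: nat set)}"

text \<open>
  The degree \<open>0\<close> part, for the weights \<open>w\<close>, of the localization of the hypersurface ring at \<open>z\<close>:
  fractions whose numerator is homogeneous of the degree of the denominator.
\<close>

definition D_plus_z :: "nat \<Rightarrow> (coord \<Rightarrow> int) \<Rightarrow> poly_xyzs \<Rightarrow>
    (poly_xyzs set \<times> poly_xyzs set) set gm_algebra" where
  "D_plus_z k w F =
     (localization (hypersurface_ring k F) (z_powers k F))
       \<lparr>carrier :=
          {frac (hypersurface_ring k F) (z_powers k F)
             (residue_class k F p)
             (residue_class k F (coord_poly Coord_z) [^]\<^bsub>hypersurface_ring k F\<^esub> n)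
           | p (n :: nat). weighted_homogeneous w (int n * w Coord_z) p}\<rparr>"

text \<open>The polynomial \<open>Q(s\<^sup>d / z) z\<^bsup>deg Q\<^esup>\<close>.\<close>

definition homog_poly :: "nat \<Rightarrow> complex poly \<Rightarrow> poly_xyzs" where
  "homog_poly d Q =
     (\<Sum>j \<le> Polynomial.degree Q.
        Poly_Mapping.single 0 (Polynomial.coeff Q j) *
        (coord_poly Coord_s ^ d) ^ j * coord_poly Coord_z ^ (Polynomial.degree Q - j))"

text \<open>
  The exponent \<open>k (ep + em)\<close> of \<open>s\<close> is nonnegative when the sum of the two divisors is
  anti-effective.
\<close>

definition hypersurface_poly :: "nat \<Rightarrow> nat \<Rightarrow> int \<Rightarrow> int \<Rightarrow> complex poly \<Rightarrow> poly_xyzs" where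
  "hypersurface_poly d k ep em Q =
     coord_poly Coord_x ^ k * coord_poly Coord_y
     - coord_poly Coord_s ^ nat (int k * (ep + em)) * homog_poly d Q"

fun weight :: "nat \<Rightarrow> nat \<Rightarrow> int \<Rightarrow> int \<Rightarrow> complex poly \<Rightarrow> coord \<Rightarrow> int" where
  "weight d k ep em Q Coord_x = ep"
| "weight d k ep em Q Coord_y = int k * em + int d * int (Polynomial.degree Q)"
| "weight d k ep em Q Coord_z = int d"
| "weight d k ep em Q Coord_s = 1"

lemma weighted_homogeneous_coord: "weighted_homogeneous w (w v) (coord_poly v)"
  by (cases v) (auto simp: weighted_homogeneous_def coord_poly_def lookup_single)

lemma weighted_homogeneous_const: "weighted_homogeneous w 0 (Poly_Mapping.single 0 c)"
  by (auto simp: weighted_homogeneous_def)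

lemma weighted_homogeneous_mult:
  assumes "weighted_homogeneous w m p" "weighted_homogeneous w n q"
  shows "weighted_homogeneous w (m + n) (p * q)"
  unfolding weighted_homogeneous_def
proof
  fix a assume "a \<in> Poly_Mapping.keys (p * q)"
  then obtain b c where "b \<in> Poly_Mapping.keys p" "c \<in> Poly_Mapping.keys q" "a = b + c"
    using keys_mult [of p q] by blast
  then show "(\<Sum>v \<in> {Coord_x, Coord_y, Coord_z, Coord_s}.
      w v * int (Poly_Mapping.lookup a v)) = m + n"
    using assms by (fastforce simp: weighted_homogeneous_def lookup_add algebra_simps)
qed

lemma weighted_homogeneous_power:
  "weighted_homogeneous w m p \<Longrightarrow> weighted_homogeneous w (int n * m) (p ^ n)"
proof (induction n)
  case 0
  show ?case
    using weighted_homogeneous_const [of w 1] by simp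
next
  case (Suc n)
  then show ?case
    using weighted_homogeneous_mult [of w m p "int n * m" "p ^ n"] by (simp add: algebra_simps)
qed

lemma weighted_homogeneous_diff:
  "weighted_homogeneous w m p \<Longrightarrow> weighted_homogeneous w m q \<Longrightarrow> weighted_homogeneous w m (p - q)"
  using keys_diff [of p q] unfolding weighted_homogeneous_def by blast

lemma weighted_homogeneous_sum:
  "(\<And>j. j \<in> J \<Longrightarrow> weighted_homogeneous w m (f j)) \<Longrightarrow> weighted_homogeneous w m (sum f J)"
  using keys_sum [of f J] unfolding weighted_homogeneous_def by blast

lemma weighted_homogeneous_hypersurface_poly:
  assumes "ep + em \<ge> 0"
  shows "weighted_homogeneous (weight d k ep em Q)
    (int k * (ep + em) + int d * int (Polynomial.degree Q)) (hypersurface_poly d k ep em Q)"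
proof -
  let ?h = "weighted_homogeneous (weight d k ep em Q)"
  let ?N = "Polynomial.degree Q"
  note coord = weighted_homogeneous_coord [of "weight d k ep em Q"]
  have "?h (int d * int ?N) (Poly_Mapping.single 0 (Polynomial.coeff Q j) *
      (coord_poly Coord_s ^ d) ^ j * coord_poly Coord_z ^ (?N - j))" if "j \<le> ?N" for j
  proof -
    have "?h (0 + int j * (int d * 1) + int (?N - j) * int d)
      (Poly_Mapping.single 0 (Polynomial.coeff Q j) *
        (coord_poly Coord_s ^ d) ^ j * coord_poly Coord_z ^ (?N - j))"
      using coord [of Coord_s] coord [of Coord_z]
      by (intro weighted_homogeneous_mult weighted_homogeneous_const weighted_homogeneous_power)
         simp_all
    moreover have "0 + int j * (int d * 1) + int (?N - j) * int d = int d * int ?N"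
      using that by (simp add: of_nat_diff algebra_simps)
    ultimately show ?thesis by simp
  qed
  then have "?h (int d * int ?N) (homog_poly d Q)"
    unfolding homog_poly_def by (intro weighted_homogeneous_sum) simp
  moreover have "?h (int (nat (int k * (ep + em))) * 1)
      (coord_poly Coord_s ^ nat (int k * (ep + em)))"
    using coord [of Coord_s] by (intro weighted_homogeneous_power) simp
  ultimately have "?h (int k * (ep + em) + int d * int ?N)
      (coord_poly Coord_s ^ nat (int k * (ep + em)) * homog_poly d Q)"
    using assms weighted_homogeneous_mult by fastforce
  moreover have "?h (int k * ep + (int k * em + int d * int ?N))
      (coord_poly Coord_x ^ k * coord_poly Coord_y)"
    using coord [of Coord_x] coord [of Coord_y]
    by (intro weighted_homogeneous_mult weighted_homogeneous_power) simp_all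
  ultimately show ?thesis
    unfolding hypersurface_poly_def
    by (intro weighted_homogeneous_diff) (simp_all add: algebra_simps)
qed

end

theory Submission
  imports Defs "Jordan_Normal_Form.Char_Poly"
begin

text \<open>
  On the chart \<open>z \<noteq> 0\<close> put \<open>t = s\<^sup>d / z\<close>. A homogeneous element of degree \<open>0\<close> of \<open>R[1/z]\<close> does
  not change when one substitutes \<open>s = 1\<close>, and then \<open>z = 1 / t\<close>, \<open>x = u\<close> and, by \<open>F = 0\<close>,
  \<open>y = u\<^bsup>-k\<^esup> Q(t) t\<^bsup>-deg Q\<^esup>\<close>. This gives an equivariant homomorphism \<open>B \<rightarrow> \<complex>(t)[u, 1/u]\<close> from the
  coordinate ring \<open>B\<close> of the chart. It is injective: modulo \<open>F\<close> every polynomial is a combination of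
  monomials not divisible by \<open>x\<^sup>k y\<close>, and such monomials of a fixed weighted degree have linearly
  independent images, because the exponent of \<open>u\<close> determines those of \<open>x\<close> and \<open>y\<close>.

  The image contains \<open>t\<close> and \<open>t u\<close>, hence has fraction field \<open>\<complex>(t, u)\<close>, and it lies in \<open>A\<close>. If
  \<open>f u\<^sup>i\<close> lies in \<open>A\<close>, the divisor conditions on \<open>f\<close> say that its \<open>d k\<close>-th power is a polynomial in
  \<open>t\<close> times the image of a power of \<open>x\<close> or \<open>y\<close> divided by a power of \<open>z\<close>. So \<open>A\<close> is integral over \<open>B\<close>,
  and being integrally closed it is the normalization of \<open>B\<close>.
\<close>

section \<open>Integral elements over a subring\<close>

text \<open>Both coordinate rings are embedded in one field, \<open>laurent fract\<close>. There the
  claim becomes an equality of subsets, and the isomorphism can only send \<open>a\<close> to the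
  element with the same value. The obstacle is that setting s = 1 is not injective modulo F: it
  kills s - 1. So only homogeneous elements are compared, every reduction modulo F has to preserve
  the weighted degree, and R is treated as a mere commutative ring, localized at z in that
  generality. The inequalities on the coefficients act at different places: e_+ \<le> d makes t u =
  x s^(d - e_+) / z regular on the chart, and e_+ + e_- \<ge> 0 puts the image of the chart inside
  A. The exponent d k arises because d clears the denominators of the coefficients at 0 and k the
  one of D_0 / k. It settles homogeneous elements only; general elements of A are sums of these,
  hence the closure of integrality under addition, proved through characteristic
  polynomials.\<close>

definition subring_of :: "'a :: comm_ring_1 set \<Rightarrow> bool" where
  "subring_of S \<longleftrightarrow> 1 \<in> S \<and> (\<forall>a \<in> S. \<forall>b \<in> S. a - b \<in> S \<and> a * b \<in> S)"

lemma subring_of_closed: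
  assumes "subring_of S"
  shows subring_of_1: "1 \<in> S"
    and subring_of_0: "0 \<in> S"
    and subring_of_diff: "a \<in> S \<Longrightarrow> b \<in> S \<Longrightarrow> a - b \<in> S"
    and subring_of_mult: "a \<in> S \<Longrightarrow> b \<in> S \<Longrightarrow> a * b \<in> S"
    and subring_of_uminus: "a \<in> S \<Longrightarrow> - a \<in> S"
    and subring_of_add: "a \<in> S \<Longrightarrow> b \<in> S \<Longrightarrow> a + b \<in> S"
proof -
  show "1 \<in> S" and diff: "\<And>a b. a \<in> S \<Longrightarrow> b \<in> S \<Longrightarrow> a - b \<in> S"
    and "a \<in> S \<Longrightarrow> b \<in> S \<Longrightarrow> a * b \<in> S"
    using assms by (auto simp: subring_of_def)
  then show zero: "0 \<in> S" by fastforce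
  show minus: "- a \<in> S" if "a \<in> S" for a using diff [OF zero that] by simp
  show "a + b \<in> S" if "a \<in> S" "b \<in> S" using diff [OF that(1) minus [OF that(2)]] by simp
qed

lemma subring_of_sum:
  "subring_of S \<Longrightarrow> (\<And>i. i \<in> I \<Longrightarrow> f i \<in> S) \<Longrightarrow> sum f I \<in> S"
  by (induction I rule: infinite_finite_induct) (auto intro: subring_of_0 subring_of_add)

lemma subring_of_prod:
  "subring_of S \<Longrightarrow> (\<And>i. i \<in> I \<Longrightarrow> f i \<in> S) \<Longrightarrow> prod f I \<in> S"
  by (induction I rule: infinite_finite_induct) (auto intro: subring_of_1 subring_of_mult)

section \<open>Monic equations over a subring\<close>

definition polys_over :: "'a :: comm_ring_1 set \<Rightarrow> 'a poly set" where
  "polys_over S = {p. \<forall>i. Polynomial.coeff p i \<in> S}"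

lemma subring_of_polys_over:
  assumes S: "subring_of S"
  shows "subring_of (polys_over S)"
  unfolding subring_of_def
proof (intro conjI ballI)
  show "1 \<in> polys_over S"
    using S by (auto simp: polys_over_def subring_of_0 subring_of_1)
  fix p q assume "p \<in> polys_over S" "q \<in> polys_over S"
  then show "p - q \<in> polys_over S" "p * q \<in> polys_over S"
    using S by (auto simp: polys_over_def coeff_mult
        intro!: subring_of_diff subring_of_mult subring_of_sum)
qed

definition integral_over :: "'a :: comm_ring_1 set \<Rightarrow> 'a \<Rightarrow> bool" where
  "integral_over S x \<longleftrightarrow> (\<exists>p \<in> polys_over S. lead_coeff p = 1 \<and> poly p x = 0)"

text \<open>The Leibniz formula makes the determinant of X - A a signed sum of products of entries,
  all of which lie in the subring of polynomials over \<open>S\<close>.\<close>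

lemma char_poly_in_polys_over:
  assumes S: "subring_of S" and A: "A \<in> carrier_mat n n"
    and entries: "\<And>i j. i < n \<Longrightarrow> j < n \<Longrightarrow> A $$ (i, j) \<in> S"
  shows "char_poly A \<in> polys_over S"
proof -
  note P = subring_of_polys_over [OF S]
  have entry: "char_poly_matrix A $$ (i, j) \<in> polys_over S" if "i < n" "j < n" for i j
  proof -
    have "[:0, 1:] \<in> polys_over S" "[:- A $$ (i, j):] \<in> polys_over S"
      "[:- A $$ (i, j), 1:] \<in> polys_over S"
      using S entries [OF that]
      by (auto simp: polys_over_def coeff_pCons subring_of_0 subring_of_1 subring_of_uminus
          split: nat.split)
    then show ?thesis
      using that A unfolding char_poly_matrix_def by (auto simp: one_pCons)
  qed
  have closed: "char_poly_matrix A \<in> carrier_mat n n" using A by simp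
  have "char_poly_matrix A $$ (i, p i) \<in> polys_over S" if "p permutes {0..<n}" "i \<in> {0..<n}" for p i
    using entry permutes_in_image [OF that(1), of i] that(2) by simp
  then have "det (char_poly_matrix A) \<in> polys_over S"
    unfolding det_def' [OF closed]
    by (intro subring_of_sum [OF P] subring_of_mult [OF P] subring_of_prod [OF P])
      (auto simp: sign_def P subring_of_1 subring_of_uminus)
  then show ?thesis by (simp add: char_poly_def)
qed

text \<open>The relations say that the vector of the \<open>v i\<close> is an eigenvector, with
  eigenvalue \<open>x\<close>, of a matrix over \<open>S\<close>. Hence \<open>x\<close> is a root
  of its characteristic polynomial, which is monic. One nonzero \<open>v j\<close> suffices for the
  vector to be nonzero.\<close>

lemma integral_over_determinant_trick:
  fixes S :: "'a :: field set"
  assumes S: "subring_of S" and I: "finite I" and j: "j \<in> I" "v j \<noteq> 0"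
    and span: "\<And>i. i \<in> I \<Longrightarrow> \<exists>c. (\<forall>j. c j \<in> S) \<and> x * v i = (\<Sum>j \<in> I. c j * v j)"
  shows "integral_over S x"
proof -
  define n where "n = card I"
  obtain h where h: "bij_betw h {0..<n} I"
    using ex_bij_betw_nat_finite [OF I] n_def by blast
  have "\<forall>i \<in> I. \<exists>c. (\<forall>j. c j \<in> S) \<and> x * v i = (\<Sum>j \<in> I. c j * v j)"
    using span by blast
  then obtain c where c: "\<And>i j. i \<in> I \<Longrightarrow> c i j \<in> S"
    "\<And>i. i \<in> I \<Longrightarrow> x * v i = (\<Sum>j \<in> I. c i j * v j)"
    by metis
  define A where "A = mat n n (\<lambda>(i, j). c (h i) (h j))"
  define w where "w = vec n (\<lambda>i. v (h i))"
  have A: "A \<in> carrier_mat n n" by (simp add: A_def)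
  have hI: "h i \<in> I" if "i < n" for i using h that by (auto simp: bij_betw_def)
  have "A *\<^sub>v w = x \<cdot>\<^sub>v w"
  proof (rule eq_vecI)
    fix i assume "i < dim_vec (x \<cdot>\<^sub>v w)"
    then have i: "i < n" by (simp add: w_def)
    have "(A *\<^sub>v w) $ i = (\<Sum>j = 0..<n. c (h i) (h j) * v (h j))"
      using i by (simp add: A_def w_def scalar_prod_def)
    also have "\<dots> = (\<Sum>j \<in> I. c (h i) j * v j)"
      by (rule sum.reindex_bij_betw [OF h])
    also have "\<dots> = (x \<cdot>\<^sub>v w) $ i"
      using i c(2) [OF hI [OF i]] by (simp add: w_def)
    finally show "(A *\<^sub>v w) $ i = (x \<cdot>\<^sub>v w) $ i" .
  qed (simp add: A_def w_def)
  moreover have "w \<noteq> 0\<^sub>v n"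
  proof
    assume w: "w = 0\<^sub>v n"
    obtain i where i: "i < n" "h i = j" using h j(1) by (auto simp: bij_betw_def)
    have "w $ i = v j" using i by (simp add: w_def)
    with w i j show False by simp
  qed
  ultimately have "eigenvalue A x"
    unfolding eigenvalue_def eigenvector_def using A by (auto intro!: exI [of _ w] simp: w_def)
  then have "poly (char_poly A) x = 0" using eigenvalue_root_char_poly [OF A] by simp
  moreover have "char_poly A \<in> polys_over S"
    by (rule char_poly_in_polys_over [OF S A]) (simp add: A_def c(1) hI)
  moreover have "lead_coeff (char_poly A) = 1" using degree_monic_char_poly [OF A] by simp
  ultimately show ?thesis unfolding integral_over_def by blast
qed

lemma monic_root_power:
  assumes p: "p \<in> polys_over S" "lead_coeff p = 1" "poly p x = 0" and S: "subring_of S"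
  obtains c where "\<And>i. c i \<in> S"
    "x ^ Polynomial.degree p = (\<Sum>i < Polynomial.degree p. c i * x ^ i)"
proof
  let ?n = "Polynomial.degree p"
  show "- Polynomial.coeff p i \<in> S" for i
    using p(1) S by (auto simp: polys_over_def subring_of_uminus)
  have "(\<Sum>i < ?n. Polynomial.coeff p i * x ^ i) + x ^ ?n = 0"
    using p(2,3) by (simp add: poly_altdef lessThan_Suc_atMost [symmetric])
  then show "x ^ ?n = (\<Sum>i < ?n. - Polynomial.coeff p i * x ^ i)"
    by (simp add: sum_negf add_eq_0_iff)
qed

text \<open>The \<open>S\<close>-module \<open>M\<close> spanned by the products x^i y^j below the
  two degrees is stable under multiplication by x and by y: the monic equations rewrite x^m and y^n
  by lower powers. The determinant trick then applies to x + y.\<close>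

lemma integral_over_add:
  fixes S :: "'a :: field set"
  assumes S: "subring_of S" and x: "integral_over S x" and y: "integral_over S y"
  shows "integral_over S (x + y)"
proof -
  obtain p q where p: "p \<in> polys_over S" "lead_coeff p = 1" "poly p x = 0"
    and q: "q \<in> polys_over S" "lead_coeff q = 1" "poly q y = 0"
    using x y unfolding integral_over_def by blast
  define m n where "m = Polynomial.degree p" and "n = Polynomial.degree q"
  \<comment> \<open>A monic constant is 1 and has no root. Positive degrees guarantee that the
    generator 1, at index (0, 0), is present; it is the nonzero one.\<close>
  have "m > 0" "n > 0"
    using p(2,3) q(2,3) unfolding m_def n_def by (auto elim!: degree_eq_zeroE intro!: gr0I)
  define I where "I = {..<m} \<times> {..<n}"
  define v where "v = (\<lambda>(i, j). x ^ i * y ^ j)"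
  define M where "M = {\<Sum>e \<in> I. c e * v e | c. \<forall>e. c e \<in> S}"
  have zero_M: "0 \<in> M"
    unfolding M_def by (rule CollectI, rule exI [of _ "\<lambda>_. 0"]) (simp add: subring_of_0 [OF S])
  have add_M: "a + b \<in> M" if "a \<in> M" "b \<in> M" for a b
  proof -
    obtain c where "\<forall>e. c e \<in> S" "a = (\<Sum>e \<in> I. c e * v e)"
      using \<open>a \<in> M\<close> unfolding M_def by blast
    moreover obtain c' where "\<forall>e. c' e \<in> S" "b = (\<Sum>e \<in> I. c' e * v e)"
      using \<open>b \<in> M\<close> unfolding M_def by blast
    ultimately show ?thesis unfolding M_def
      by (intro CollectI exI [of _ "\<lambda>e. c e + c' e"])
        (simp add: subring_of_add [OF S] sum.distrib distrib_right)
  qed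
  have sum_M: "sum f J \<in> M" if "\<And>i. i \<in> J \<Longrightarrow> f i \<in> M" for f and J :: "nat set"
    using that by (induction J rule: infinite_finite_induct) (auto simp: zero_M add_M)
  have gen_M: "s * (x ^ i * y ^ j) \<in> M" if "s \<in> S" "i < m" "j < n" for s i j
  proof -
    have "(\<Sum>e \<in> I. (if e = (i, j) then s else 0) * v e) = s * v (i, j)"
      using that by (simp add: I_def if_distrib [of "\<lambda>c. c * _"] cong: if_cong)
    then show ?thesis unfolding M_def using that subring_of_0 [OF S]
      by (intro CollectI exI [of _ "\<lambda>e. if e = (i, j) then s else 0"]) (simp add: v_def)
  qed
  obtain c where c: "\<And>i. c i \<in> S" "x ^ m = (\<Sum>i < m. c i * x ^ i)"
    using monic_root_power [OF p S] unfolding m_def by blast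
  obtain c' where c': "\<And>i. c' i \<in> S" "y ^ n = (\<Sum>i < n. c' i * y ^ i)"
    using monic_root_power [OF q S] unfolding n_def by blast
  have x_M: "x ^ Suc i * y ^ j \<in> M" if "i < m" "j < n" for i j
  proof (cases "Suc i = m")
    case True
    have "(\<Sum>i < m. c i * (x ^ i * y ^ j)) \<in> M"
      by (intro sum_M gen_M c(1)) (use that in auto)
    then show ?thesis using c(2) True by (simp add: sum_distrib_right mult.assoc del: power_Suc)
  next
    case False
    then show ?thesis using gen_M [OF subring_of_1 [OF S], of "Suc i" j] that by simp
  qed
  have y_M: "x ^ i * y ^ Suc j \<in> M" if "i < m" "j < n" for i j
  proof (cases "Suc j = n")
    case True
    have "(\<Sum>j < n. c' j * (x ^ i * y ^ j)) \<in> M"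
      by (intro sum_M gen_M c'(1)) (use that in auto)
    then show ?thesis using c'(2) True
      by (simp add: sum_distrib_left mult.left_commute del: power_Suc)
  next
    case False
    then show ?thesis using gen_M [OF subring_of_1 [OF S], of i "Suc j"] that by simp
  qed
  show ?thesis
  proof (rule integral_over_determinant_trick [OF S, of I "(0, 0)" v])
    show "finite I" "(0, 0) \<in> I" "v (0, 0) \<noteq> 0"
      using \<open>m > 0\<close> \<open>n > 0\<close> by (auto simp: I_def v_def)
    fix e assume "e \<in> I"
    then obtain i j where e: "e = (i, j)" "i < m" "j < n" by (auto simp: I_def)
    have "(x + y) * v e = x ^ Suc i * y ^ j + x ^ i * y ^ Suc j"
      using e by (simp add: v_def algebra_simps)
    then have "(x + y) * v e \<in> M" using add_M [OF x_M y_M] e by simp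
    then show "\<exists>c. (\<forall>j. c j \<in> S) \<and> (x + y) * v e = (\<Sum>j \<in> I. c j * v j)"
      unfolding M_def by blast
  qed
qed

lemma integral_over_self:
  assumes "subring_of S" "a \<in> S"
  shows "integral_over S a"
  unfolding integral_over_def
  by (rule bexI [of _ "[:- a, 1:]"])
    (use assms in \<open>auto simp: polys_over_def coeff_pCons subring_of_0 subring_of_1 subring_of_uminus
       split: nat.split\<close>)

lemma integral_over_sum:
  fixes S :: "'a :: field set"
  assumes S: "subring_of S" and f: "\<And>i. i \<in> I \<Longrightarrow> integral_over S (f i)"
  shows "integral_over S (sum f I)"
  using f by (induction I rule: infinite_finite_induct)
    (auto intro: integral_over_add [OF S] integral_over_self [OF S subring_of_0 [OF S]])

text \<open>The equation is X^n - x^n; for \<open>n > 0\<close> the constant term does not touch the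
  leading coefficient.\<close>

lemma integral_over_root:
  assumes S: "subring_of S" and n: "n > 0" "x ^ n \<in> S"
  shows "integral_over S x"
  unfolding integral_over_def
proof (rule bexI)
  let ?p = "Polynomial.monom 1 n - [:x ^ n:]"
  have "Polynomial.degree ?p = n"
    using n by (intro antisym degree_le le_degree)
      (auto simp: coeff_pCons split: nat.split)
  then show "lead_coeff ?p = 1 \<and> poly ?p x = 0"
    using n by (auto simp: poly_monom coeff_pCons split: nat.split)
  show "?p \<in> polys_over S"
    using assms by (auto simp: polys_over_def coeff_pCons subring_of_0 subring_of_1
        subring_of_diff subring_of_uminus split: nat.split)
qed

lemma integral_over_mono: "integral_over S x \<Longrightarrow> S \<subseteq> T \<Longrightarrow> integral_over T x"
  unfolding integral_over_def polys_over_def by blast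

section \<open>Localizations and fields of fractions\<close>

text \<open>The operations on a localization are unions over representatives. If all pairs yield the
  same class and some pair exists, the union is that class.\<close>

lemma UN_pairs_const:
  assumes "p \<in> U" "q \<in> V" "\<And>a s b t. (a, s) \<in> U \<Longrightarrow> (b, t) \<in> V \<Longrightarrow> f a s b t = T"
  shows "(\<Union>(a, s) \<in> U. \<Union>(b, t) \<in> V. f a s b t) = T"
  using assms by (cases p; cases q) fastforce

text \<open>Cancellation is not assumed. The locale serves twice: for the nonzero elements of a
  domain, and for the powers of z in R, which is only known to be a commutative ring.\<close>

locale mult_closed_set = cring A for A :: "'a gm_algebra" (structure) +
  fixes S :: "'a set"
  assumes S_carrier: "s \<in> S \<Longrightarrow> s \<in> carrier A" and S_one: "\<one> \<in> S"
    and S_mult: "s \<in> S \<Longrightarrow> t \<in> S \<Longrightarrow> s \<otimes> t \<in> S"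
begin

lemma mem_frac_iff:
  "(b, t) \<in> frac A S a s \<longleftrightarrow>
     b \<in> carrier A \<and> t \<in> S \<and> (\<exists>u \<in> S. u \<otimes> (a \<otimes> t) = u \<otimes> (b \<otimes> s))"
  by (simp add: frac_def)

lemma frac_self: "a \<in> carrier A \<Longrightarrow> s \<in> S \<Longrightarrow> (a, s) \<in> frac A S a s"
  using S_one by (auto simp: mem_frac_iff)

lemma frac_subset:
  assumes a: "a \<in> carrier A" "b \<in> carrier A" "s \<in> S" "t \<in> S"
    and u: "u \<in> S" "u \<otimes> (a \<otimes> t) = u \<otimes> (b \<otimes> s)"
  shows "frac A S a s \<subseteq> frac A S b t"
proof
  fix x assume "x \<in> frac A S a s"
  then obtain c r v where x: "x = (c, r)" "c \<in> carrier A" "r \<in> S" "v \<in> S"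
    "v \<otimes> (a \<otimes> r) = v \<otimes> (c \<otimes> s)"
    by (cases x) (auto simp: mem_frac_iff)
  note [simp] = S_carrier [OF a(3)] S_carrier [OF a(4)] S_carrier [OF u(1)]
    S_carrier [OF x(3)] S_carrier [OF x(4)] a(1,2) x(2)
  \<comment> \<open>Transitivity of the equivalence of fractions. The middle denominator
    \<open>s\<close> cannot be cancelled and becomes part of the witness.\<close>
  have "(u \<otimes> v \<otimes> s) \<otimes> (b \<otimes> r) = (v \<otimes> r) \<otimes> (u \<otimes> (b \<otimes> s))" by (simp add: m_ac)
  also have "\<dots> = (v \<otimes> r) \<otimes> (u \<otimes> (a \<otimes> t))" using u(2) by simp
  also have "\<dots> = (u \<otimes> t) \<otimes> (v \<otimes> (a \<otimes> r))" by (simp add: m_ac)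
  also have "\<dots> = (u \<otimes> t) \<otimes> (v \<otimes> (c \<otimes> s))" using x(5) by simp
  also have "\<dots> = (u \<otimes> v \<otimes> s) \<otimes> (c \<otimes> t)" by (simp add: m_ac)
  finally show "x \<in> frac A S b t"
    using x a u by (auto simp: mem_frac_iff intro!: bexI [of _ "u \<otimes> v \<otimes> s"] S_mult)
qed

lemma frac_eq_iff:
  assumes "a \<in> carrier A" "b \<in> carrier A" "s \<in> S" "t \<in> S"
  shows "frac A S a s = frac A S b t \<longleftrightarrow> (\<exists>u \<in> S. u \<otimes> (a \<otimes> t) = u \<otimes> (b \<otimes> s))"
proof
  assume "frac A S a s = frac A S b t"
  then have "(b, t) \<in> frac A S a s" using frac_self [of b t] assms by simp
  then show "\<exists>u \<in> S. u \<otimes> (a \<otimes> t) = u \<otimes> (b \<otimes> s)" by (simp add: mem_frac_iff)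
next
  assume "\<exists>u \<in> S. u \<otimes> (a \<otimes> t) = u \<otimes> (b \<otimes> s)"
  then show "frac A S a s = frac A S b t"
    using frac_subset [of a b s t] frac_subset [of b a t s] assms by (metis subset_antisym)
qed

lemma frac_eqI:
  "a \<in> carrier A \<Longrightarrow> b \<in> carrier A \<Longrightarrow> s \<in> S \<Longrightarrow> t \<in> S \<Longrightarrow> u \<in> S \<Longrightarrow>
     u \<otimes> (a \<otimes> t) = u \<otimes> (b \<otimes> s) \<Longrightarrow> frac A S a s = frac A S b t"
  using frac_eq_iff by blast

lemma frac_mult:
  assumes a: "a \<in> carrier A" "b \<in> carrier A" "s \<in> S" "t \<in> S"
  shows "frac A S a s \<otimes>\<^bsub>localization A S\<^esub> frac A S b t = frac A S (a \<otimes> b) (s \<otimes> t)"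
proof -
  have "(\<Union>(a', s') \<in> frac A S a s. \<Union>(b', t') \<in> frac A S b t. frac A S (a' \<otimes> b') (s' \<otimes> t')) =
      frac A S (a \<otimes> b) (s \<otimes> t)"
  proof (rule UN_pairs_const [OF frac_self [OF a(1,3)] frac_self [OF a(2,4)]])
    fix a' s' b' t' assume "(a', s') \<in> frac A S a s" "(b', t') \<in> frac A S b t"
    then obtain u v where *: "a' \<in> carrier A" "s' \<in> S" "u \<in> S" "u \<otimes> (a \<otimes> s') = u \<otimes> (a' \<otimes> s)"
      "b' \<in> carrier A" "t' \<in> S" "v \<in> S" "v \<otimes> (b \<otimes> t') = v \<otimes> (b' \<otimes> t)"
      by (auto simp: mem_frac_iff)
    note [simp] = S_carrier [OF a(3)] S_carrier [OF a(4)] S_carrier [OF *(2)]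
      S_carrier [OF *(3)] S_carrier [OF *(6)] S_carrier [OF *(7)] a(1,2) *(1,5)
    have "(u \<otimes> v) \<otimes> ((a' \<otimes> b') \<otimes> (s \<otimes> t)) = (u \<otimes> (a' \<otimes> s)) \<otimes> (v \<otimes> (b' \<otimes> t))"
      by (simp add: m_ac)
    also have "\<dots> = (u \<otimes> (a \<otimes> s')) \<otimes> (v \<otimes> (b \<otimes> t'))" using * by simp
    also have "\<dots> = (u \<otimes> v) \<otimes> ((a \<otimes> b) \<otimes> (s' \<otimes> t'))" by (simp add: m_ac)
    finally show "frac A S (a' \<otimes> b') (s' \<otimes> t') = frac A S (a \<otimes> b) (s \<otimes> t)"
      using * a by (intro frac_eqI [of _ _ _ _ "u \<otimes> v"]) (auto intro: S_mult)
  qed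
  then show ?thesis by (simp add: localization_def)
qed

lemma frac_add:
  assumes a: "a \<in> carrier A" "b \<in> carrier A" "s \<in> S" "t \<in> S"
  shows "frac A S a s \<oplus>\<^bsub>localization A S\<^esub> frac A S b t =
    frac A S ((a \<otimes> t) \<oplus> (b \<otimes> s)) (s \<otimes> t)"
proof -
  have "(\<Union>(a', s') \<in> frac A S a s. \<Union>(b', t') \<in> frac A S b t.
        frac A S ((a' \<otimes> t') \<oplus> (b' \<otimes> s')) (s' \<otimes> t')) =
      frac A S ((a \<otimes> t) \<oplus> (b \<otimes> s)) (s \<otimes> t)"
  proof (rule UN_pairs_const [OF frac_self [OF a(1,3)] frac_self [OF a(2,4)]])
    fix a' s' b' t' assume "(a', s') \<in> frac A S a s" "(b', t') \<in> frac A S b t"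
    then obtain u v where *: "a' \<in> carrier A" "s' \<in> S" "u \<in> S" "u \<otimes> (a \<otimes> s') = u \<otimes> (a' \<otimes> s)"
      "b' \<in> carrier A" "t' \<in> S" "v \<in> S" "v \<otimes> (b \<otimes> t') = v \<otimes> (b' \<otimes> t)"
      by (auto simp: mem_frac_iff)
    note [simp] = S_carrier [OF a(3)] S_carrier [OF a(4)] S_carrier [OF *(2)]
      S_carrier [OF *(3)] S_carrier [OF *(6)] S_carrier [OF *(7)] a(1,2) *(1,5)
    have "(u \<otimes> v) \<otimes> (((a' \<otimes> t') \<oplus> (b' \<otimes> s')) \<otimes> (s \<otimes> t)) =
        (v \<otimes> (t \<otimes> t')) \<otimes> (u \<otimes> (a' \<otimes> s)) \<oplus> (u \<otimes> (s \<otimes> s')) \<otimes> (v \<otimes> (b' \<otimes> t))"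
      by (simp add: m_ac r_distr l_distr)
    also have "\<dots> = (v \<otimes> (t \<otimes> t')) \<otimes> (u \<otimes> (a \<otimes> s')) \<oplus> (u \<otimes> (s \<otimes> s')) \<otimes> (v \<otimes> (b \<otimes> t'))"
      using * by simp
    also have "\<dots> = (u \<otimes> v) \<otimes> (((a \<otimes> t) \<oplus> (b \<otimes> s)) \<otimes> (s' \<otimes> t'))"
      by (simp add: m_ac r_distr l_distr)
    finally show "frac A S ((a' \<otimes> t') \<oplus> (b' \<otimes> s')) (s' \<otimes> t') =
        frac A S ((a \<otimes> t) \<oplus> (b \<otimes> s)) (s \<otimes> t)"
      using * a by (intro frac_eqI [of _ _ _ _ "u \<otimes> v"]) (auto intro: S_mult)
  qed
  then show ?thesis by (simp add: localization_def)
qed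

lemma frac_torus:
  assumes hom: "torus A l \<in> Ring.ring_hom A A" and S: "\<And>s. s \<in> S \<Longrightarrow> torus A l s \<in> S"
    and a: "a \<in> carrier A" "s \<in> S"
  shows "torus (localization A S) l (frac A S a s) = frac A S (torus A l a) (torus A l s)"
proof -
  have "frac A S (torus A l a') (torus A l s') = frac A S (torus A l a) (torus A l s)"
    if "(a', s') \<in> frac A S a s" for a' s'
  proof -
    obtain u where *: "a' \<in> carrier A" "s' \<in> S" "u \<in> S" "u \<otimes> (a \<otimes> s') = u \<otimes> (a' \<otimes> s)"
      using \<open>(a', s') \<in> _\<close> by (auto simp: mem_frac_iff)
    have "torus A l (u \<otimes> (a \<otimes> s')) = torus A l (u \<otimes> (a' \<otimes> s))"
      using *(4) by (rule arg_cong)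
    then have "torus A l u \<otimes> (torus A l a \<otimes> torus A l s') =
        torus A l u \<otimes> (torus A l a' \<otimes> torus A l s)"
      using *(1-3) a by (simp add: ring_hom_mult [OF hom] S_carrier)
    then show ?thesis
      using * a by (intro frac_eqI [of _ _ _ _ "torus A l u"])
        (auto intro: S ring_hom_closed [OF hom])
  qed
  then have "(\<Union>(a', s') \<in> frac A S a s. frac A S (torus A l a') (torus A l s')) =
      frac A S (torus A l a) (torus A l s)"
    using frac_self [OF a] by fast
  then show ?thesis by (simp add: localization_def)
qed

end

section \<open>Domains embedded in a field given as a type\<close>

locale ring_embedding = domain R for R :: "('a, 'm) ring_scheme" (structure) +
  fixes g :: "'a \<Rightarrow> 'f :: field"
  assumes g_inj: "inj_on g (carrier R)"
    and g_mult: "x \<in> carrier R \<Longrightarrow> y \<in> carrier R \<Longrightarrow> g (x \<otimes> y) = g x * g y"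
    and g_add: "x \<in> carrier R \<Longrightarrow> y \<in> carrier R \<Longrightarrow> g (x \<oplus> y) = g x + g y"
    and g_one: "g \<one> = 1"
begin

lemma g_zero: "g \<zero> = 0"
proof -
  have "g \<zero> + g \<zero> = g \<zero> + 0" using g_add [of \<zero> \<zero>] by simp
  then show ?thesis by (simp only: add_left_cancel)
qed

lemma g_eq_iff: "x \<in> carrier R \<Longrightarrow> y \<in> carrier R \<Longrightarrow> g x = g y \<longleftrightarrow> x = y"
  using g_inj by (auto simp: inj_on_def)

lemma g_eq_0_iff: "x \<in> carrier R \<Longrightarrow> g x = 0 \<longleftrightarrow> x = \<zero>"
  using g_eq_iff [of x \<zero>] by (simp add: g_zero)

lemma g_uminus: "x \<in> carrier R \<Longrightarrow> g (\<ominus> x) = - g x"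
  using g_add [of "\<ominus> x" x] by (simp add: l_neg g_zero eq_neg_iff_add_eq_0)

lemma g_pow: "x \<in> carrier R \<Longrightarrow> g (x [^] (n :: nat)) = g x ^ n"
  by (induction n) (simp_all add: g_one g_mult)

text \<open>List polynomials begin with the leading coefficient, \<open>Poly\<close> with the
  constant one; hence \<open>rev\<close>.\<close>

lemma g_eval:
  "set p \<subseteq> carrier R \<Longrightarrow> x \<in> carrier R \<Longrightarrow>
     eval p x \<in> carrier R \<and> g (eval p x) = poly (Poly (rev (map g p))) (g x)"
  by (induction p)
    (auto simp: g_zero g_add g_mult g_pow Poly_snoc poly_monom)

text \<open>The bridge from list polynomials over a carrier to type-class polynomials: from here on,
  integral closures are computed in the field.\<close>

lemma integral_closure_iff:
  assumes k: "k \<subseteq> carrier R" "\<zero> \<in> k" "\<one> \<in> k"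
  shows "x \<in> integral_closure R k \<longleftrightarrow> x \<in> carrier R \<and> integral_over (g ` k) (g x)"
proof
  assume "x \<in> integral_closure R k"
  then obtain p where x: "x \<in> carrier R" and p: "set p \<subseteq> k" "p \<noteq> []" "hd p = \<one>" "eval p x = \<zero>"
    unfolding integral_closure_def univ_poly_def polynomial_def by auto
  let ?q = "Poly (rev (map g p))"
  obtain p' where p': "p = \<one> # p'" using p(2,3) by (cases p) auto
  have "poly ?q (g x) = 0" using g_eval [of p x] p k x by (auto simp: g_zero)
  moreover have "?q \<in> polys_over (g ` k)"
    unfolding polys_over_def
  proof (intro CollectI allI)
    \<comment> \<open>Coefficients beyond the length of the list are 0, so \<open>k\<close> has to
      contain \<open>\<zero>\<close>.\<close>
    fix i
    show "Polynomial.coeff ?q i \<in> g ` k"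
    proof (cases "i < length p")
      case True
      then have "Polynomial.coeff ?q i = g (rev p ! i)" "rev p ! i \<in> set p"
        by (simp_all add: nth_default_def rev_nth)
      then show ?thesis using p(1) by auto
    next
      case False
      then have "Polynomial.coeff ?q i = g \<zero>" by (simp add: nth_default_def g_zero)
      then show ?thesis using k(2) by simp
    qed
  qed
  moreover have "lead_coeff ?q = 1"
  proof -
    have "Polynomial.degree ?q = length p'"
      using p' by (intro antisym degree_le le_degree)
        (auto simp: nth_default_def nth_append g_one)
    then show ?thesis using p' by (simp add: nth_default_def nth_append g_one)
  qed
  ultimately show "x \<in> carrier R \<and> integral_over (g ` k) (g x)"
    using x unfolding integral_over_def by blast
next
  assume "x \<in> carrier R \<and> integral_over (g ` k) (g x)"
  then obtain q where x: "x \<in> carrier R"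
    and q: "q \<in> polys_over (g ` k)" "lead_coeff q = 1" "poly q (g x) = 0"
    unfolding integral_over_def by blast
  \<comment> \<open>Each coefficient is lifted back to \<open>k\<close>; injectivity of
    \<open>g\<close> makes the lift of the leading 1 equal to \<open>\<one>\<close>.\<close>
  define p where "p = rev (map (inv_into k g) (coeffs q))"
  have q0: "q \<noteq> 0" using q(2) by auto
  have inv: "inv_into k g c \<in> k" "g (inv_into k g c) = c" if "c \<in> set (coeffs q)" for c
  proof -
    have "c \<in> g ` k" using that q(1) by (auto simp: polys_over_def coeffs_def simp del: upt_Suc split: if_splits)
    then show "inv_into k g c \<in> k" "g (inv_into k g c) = c"
      by (auto intro: inv_into_into f_inv_into_f)
  qed
  have "map g (rev p) = coeffs q"
    using inv(2) by (simp add: p_def map_idI)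
  then have Pq: "Poly (rev (map g p)) = q" by (simp add: rev_map)
  have p: "set p \<subseteq> k" using inv(1) by (auto simp: p_def)
  have "eval p x = \<zero>"
    using g_eval [OF subset_trans [OF p k(1)] x] g_eq_0_iff [of "eval p x"] q(3) by (simp add: Pq)
  moreover have ne: "p \<noteq> []" using q0 by (simp add: p_def)
  moreover have "hd p = \<one>"
  proof -
    have "last (coeffs q) = 1" using q(2) q0 by (simp add: last_coeffs_eq_coeff_degree)
    moreover have "coeffs q \<noteq> []" using q0 by simp
    ultimately have "1 \<in> set (coeffs q)" "hd p = inv_into k g 1"
      by (metis last_in_set, simp add: p_def hd_rev last_map)
    then have "hd p \<in> k" "g (hd p) = 1" using inv by auto
    then show ?thesis using g_eq_iff [of "hd p" \<one>] k by (auto simp: g_one)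
  qed
  moreover have "p \<in> carrier (k[X]\<^bsub>R\<^esub>)"
    using p \<open>hd p = \<one>\<close> by (simp add: univ_poly_def polynomial_def)
  ultimately show "x \<in> integral_closure R k"
    using x unfolding integral_closure_def by blast
qed

end

text \<open>Every axiom is pulled back from the field along the injection. Nothing is presupposed
  about \<open>R\<close> beyond closure, so fraction rings and the chart both become domains this
  way.\<close>

lemma domainI_embedding:
  fixes R (structure) and g :: "'a \<Rightarrow> 'f :: field"
  assumes inj: "inj_on g (carrier R)"
    and closed: "\<one> \<in> carrier R" "\<zero> \<in> carrier R"
      "\<And>x y. x \<in> carrier R \<Longrightarrow> y \<in> carrier R \<Longrightarrow> x \<otimes> y \<in> carrier R"
      "\<And>x y. x \<in> carrier R \<Longrightarrow> y \<in> carrier R \<Longrightarrow> x \<oplus> y \<in> carrier R"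
      "\<And>x. x \<in> carrier R \<Longrightarrow> \<exists>y \<in> carrier R. g y = - g x"
    and hom: "g \<one> = 1" "g \<zero> = 0"
      "\<And>x y. x \<in> carrier R \<Longrightarrow> y \<in> carrier R \<Longrightarrow> g (x \<otimes> y) = g x * g y"
      "\<And>x y. x \<in> carrier R \<Longrightarrow> y \<in> carrier R \<Longrightarrow> g (x \<oplus> y) = g x + g y"
  shows "domain R"
proof -
  have eqI: "x = y" if "g x = g y" "x \<in> carrier R" "y \<in> carrier R" for x y
    using inj that by (auto simp: inj_on_def)
  have "cring R"
  proof (intro cringI abelian_groupI comm_monoidI)
    fix x assume x: "x \<in> carrier R"
    then obtain y where y: "y \<in> carrier R" "g y = - g x" using closed(5) by blast
    then have "y \<oplus> x = \<zero>" using x closed hom by (intro eqI) auto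
    then show "\<exists>y \<in> carrier R. y \<oplus> x = \<zero>" using y by blast
  qed (auto intro!: eqI simp: closed hom algebra_simps)
  moreover have "\<one> \<noteq> \<zero>" using hom by (metis zero_neq_one)
  moreover have "a = \<zero> \<or> b = \<zero>" if "a \<otimes> b = \<zero>" "a \<in> carrier R" "b \<in> carrier R" for a b
  proof -
    have "g a * g b = 0" using hom(2,3) that by metis
    then have "g a = 0 \<or> g b = 0" by simp
    then show ?thesis using eqI [of a \<zero>] eqI [of b \<zero>] that closed hom by auto
  qed
  ultimately show ?thesis by (intro domain.intro domain_axioms.intro)
qed

section \<open>The field of fractions of an embedded domain\<close>

locale gm_algebra_embedding = ring_embedding A g for A :: "'a gm_algebra" (structure) and g
begin

abbreviation "S \<equiv> non_zero_divisors A"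

lemma non_zero_divisors_iff: "s \<in> S \<longleftrightarrow> s \<in> carrier A \<and> s \<noteq> \<zero>"
proof
  assume s: "s \<in> S"
  then have "s \<otimes> \<one> = \<zero> \<longrightarrow> \<one> = \<zero>" unfolding non_zero_divisors_def by blast
  then show "s \<in> carrier A \<and> s \<noteq> \<zero>" using s by (auto simp: non_zero_divisors_def)
qed (use integral in \<open>auto simp: non_zero_divisors_def\<close>)

sublocale mult_closed_set A S
  by unfold_locales (auto simp: non_zero_divisors_iff integral_iff)

text \<open>The extension of \<open>g\<close> to fractions, through an arbitrary representative;
  \<open>val_frac\<close> shows that the choice is immaterial.\<close>

definition val :: "('a \<times> 'a) set \<Rightarrow> 'b" where
  "val U = (case SOME p. p \<in> U of (a, s) \<Rightarrow> g a / g s)"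

lemma g_S: "s \<in> S \<Longrightarrow> g s \<noteq> 0"
  by (simp add: non_zero_divisors_iff g_eq_0_iff)

lemma val_frac:
  assumes "a \<in> carrier A" "s \<in> S"
  shows "val (frac A S a s) = g a / g s"
proof -
  have "(SOME p. p \<in> frac A S a s) \<in> frac A S a s" using frac_self [OF assms] by (rule someI)
  then obtain b t u where bt: "(SOME p. p \<in> frac A S a s) = (b, t)" "b \<in> carrier A" "t \<in> S"
    "u \<in> S" "u \<otimes> (a \<otimes> t) = u \<otimes> (b \<otimes> s)"
    by (cases "SOME p. p \<in> frac A S a s") (auto simp: mem_frac_iff)
  have "g (u \<otimes> (a \<otimes> t)) = g (u \<otimes> (b \<otimes> s))" using bt(5) by (rule arg_cong)
  then have "g u * (g a * g t) = g u * (g b * g s)"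
    using bt(2-4) assms by (simp add: g_mult S_carrier)
  then have "g a * g t = g b * g s" using g_S [OF bt(4)] by simp
  then show ?thesis
    using g_S [OF bt(3)] g_S [OF assms(2)] unfolding val_def bt(1) by (simp add: field_simps)
qed

lemma frac_eq_iff_val:
  assumes "a \<in> carrier A" "b \<in> carrier A" "s \<in> S" "t \<in> S"
  shows "frac A S a s = frac A S b t \<longleftrightarrow> g a / g s = g b / g t"
proof
  assume "g a / g s = g b / g t"
  then have "g (a \<otimes> t) = g (b \<otimes> s)" using assms g_S by (simp add: g_mult S_carrier field_simps)
  then have "a \<otimes> t = b \<otimes> s" using assms by (simp add: g_eq_iff S_carrier)
  then show "frac A S a s = frac A S b t" using assms S_one by (intro frac_eqI) auto
qed (metis val_frac assms)

lemma carrier_total_fractions: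
  "carrier (total_fractions A) = {frac A S a s | a s. a \<in> carrier A \<and> s \<in> S}"
  by (simp add: total_fractions_def localization_def)

lemma frac_in_total_fractions:
  "a \<in> carrier A \<Longrightarrow> s \<in> S \<Longrightarrow> frac A S a s \<in> carrier (total_fractions A)"
  unfolding carrier_total_fractions by blast

lemma val_image: "val ` carrier (total_fractions A) = {g a / g s | a s. a \<in> carrier A \<and> s \<in> S}"
proof -
  have "val ` carrier (total_fractions A) =
      {val (frac A S a s) | a s. a \<in> carrier A \<and> s \<in> S}"
    unfolding carrier_total_fractions by blast
  also have "\<dots> = {g a / g s | a s. a \<in> carrier A \<and> s \<in> S}"
    by (metis (no_types, opaque_lifting) val_frac)
  finally show ?thesis .
qed

lemma val_fractions_image: "val ` fractions_image A = g ` carrier A"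
  unfolding fractions_image_def image_image
  by (rule image_cong) (simp_all add: val_frac S_one g_one)

lemma fractions_image_subset: "fractions_image A \<subseteq> carrier (total_fractions A)"
  unfolding fractions_image_def carrier_total_fractions using S_one by blast

lemma total_fractions_embedding: "ring_embedding (total_fractions A) val"
proof -
  let ?T = "total_fractions A"
  have one: "\<one>\<^bsub>?T\<^esub> = frac A S \<one> \<one>" and zero: "\<zero>\<^bsub>?T\<^esub> = frac A S \<zero> \<one>"
    by (simp_all add: total_fractions_def localization_def)
  have inj: "inj_on val (carrier ?T)"
  proof (rule inj_onI)
    fix x y assume *: "x \<in> carrier ?T" "y \<in> carrier ?T" "val x = val y"
    obtain a s b t where "a \<in> carrier A" "s \<in> S" "b \<in> carrier A" "t \<in> S"
      "x = frac A S a s" "y = frac A S b t"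
      using *(1,2) unfolding carrier_total_fractions by blast
    then show "x = y" using *(3) by (simp add: val_frac frac_eq_iff_val)
  qed
  have mult: "x \<otimes>\<^bsub>?T\<^esub> y \<in> carrier ?T \<and> val (x \<otimes>\<^bsub>?T\<^esub> y) = val x * val y"
    and add: "x \<oplus>\<^bsub>?T\<^esub> y \<in> carrier ?T \<and> val (x \<oplus>\<^bsub>?T\<^esub> y) = val x + val y"
    if "x \<in> carrier ?T" "y \<in> carrier ?T" for x y
  proof -
    obtain a s b t where *: "a \<in> carrier A" "s \<in> S" "b \<in> carrier A" "t \<in> S"
      "x = frac A S a s" "y = frac A S b t"
      using \<open>x \<in> _\<close> \<open>y \<in> _\<close> unfolding carrier_total_fractions by blast
    have "x \<otimes>\<^bsub>?T\<^esub> y = frac A S (a \<otimes> b) (s \<otimes> t)"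
      using * by (simp add: total_fractions_def frac_mult)
    then show "x \<otimes>\<^bsub>?T\<^esub> y \<in> carrier ?T \<and> val (x \<otimes>\<^bsub>?T\<^esub> y) = val x * val y"
      using * by (simp add: frac_in_total_fractions val_frac S_mult g_mult S_carrier)
    have "x \<oplus>\<^bsub>?T\<^esub> y = frac A S ((a \<otimes> t) \<oplus> (b \<otimes> s)) (s \<otimes> t)"
      using * by (simp add: total_fractions_def frac_add)
    then show "x \<oplus>\<^bsub>?T\<^esub> y \<in> carrier ?T \<and> val (x \<oplus>\<^bsub>?T\<^esub> y) = val x + val y"
      using * by (simp add: frac_in_total_fractions val_frac S_mult g_mult g_add S_carrier
          g_S field_simps)
  qed
  have neg: "\<exists>y \<in> carrier ?T. val y = - val x" if "x \<in> carrier ?T" for x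
  proof -
    obtain a s where *: "a \<in> carrier A" "s \<in> S" "x = frac A S a s"
      using \<open>x \<in> _\<close> unfolding carrier_total_fractions by blast
    then have "frac A S (\<ominus> a) s \<in> carrier ?T" "val (frac A S (\<ominus> a) s) = - val x"
      by (simp_all add: frac_in_total_fractions val_frac g_uminus)
    then show ?thesis by blast
  qed
  have "val \<one>\<^bsub>?T\<^esub> = 1" "val \<zero>\<^bsub>?T\<^esub> = 0" "\<one>\<^bsub>?T\<^esub> \<in> carrier ?T" "\<zero>\<^bsub>?T\<^esub> \<in> carrier ?T"
    using S_one by (simp_all add: one zero val_frac g_one g_zero frac_in_total_fractions)
  then show ?thesis
    by (intro ring_embedding.intro ring_embedding_axioms.intro
        domainI_embedding [where g = val] inj) (auto simp: mult add neg)
qed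

lemma integral_closure_total_fractions:
  "x \<in> integral_closure (total_fractions A) (fractions_image A) \<longleftrightarrow>
     x \<in> carrier (total_fractions A) \<and> integral_over (g ` carrier A) (val x)"
proof -
  interpret T: ring_embedding "total_fractions A" val by (rule total_fractions_embedding)
  have "\<zero>\<^bsub>total_fractions A\<^esub> \<in> fractions_image A" "\<one>\<^bsub>total_fractions A\<^esub> \<in> fractions_image A"
    by (auto simp: fractions_image_def total_fractions_def localization_def)
  then show ?thesis
    using T.integral_closure_iff [OF fractions_image_subset] by (simp add: val_fractions_image)
qed

end

text \<open>In the common field, A and the normalization of B have the same image. One inclusion is
  \<open>int\<close> together with \<open>quot\<close>; the other is \<open>sub\<close> together
  with normality of A. The torus does not act on the field, so equivariance is assumed in
  cross-multiplied form.\<close>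

lemma equivariantly_isomorphic_normalizationI:
  fixes A :: "'a gm_algebra" and B :: "'b gm_algebra"
    and gA :: "'a \<Rightarrow> 'f :: field" and gB :: "'b \<Rightarrow> 'f"
  assumes A: "ring_embedding A gA" and B: "ring_embedding B gB"
    and sub: "gB ` carrier B \<subseteq> gA ` carrier A"
    and int: "\<And>a. a \<in> carrier A \<Longrightarrow> integral_over (gB ` carrier B) (gA a)"
    and quot: "\<And>a. a \<in> carrier A \<Longrightarrow>
      \<exists>b \<in> carrier B. \<exists>s \<in> carrier B. gB s \<noteq> 0 \<and> gA a * gB s = gB b"
    and normal: "integral_closure (total_fractions A) (fractions_image A) = fractions_image A"
    and torusA: "\<And>l a. l \<noteq> 0 \<Longrightarrow> a \<in> carrier A \<Longrightarrow> torus A l a \<in> carrier A"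
    and torusB: "\<And>l. l \<noteq> 0 \<Longrightarrow> torus B l \<in> Ring.ring_hom B B"
    and torusB_inj: "\<And>l b. l \<noteq> 0 \<Longrightarrow> b \<in> carrier B \<Longrightarrow> torus B l b = \<zero>\<^bsub>B\<^esub> \<Longrightarrow> b = \<zero>\<^bsub>B\<^esub>"
    and torus: "\<And>l a b s. l \<noteq> 0 \<Longrightarrow> a \<in> carrier A \<Longrightarrow> b \<in> carrier B \<Longrightarrow> s \<in> carrier B \<Longrightarrow>
      gA a * gB s = gB b \<Longrightarrow> gA (torus A l a) * gB (torus B l s) = gB (torus B l b)"
    and scal: "\<And>c. scal A c \<in> carrier A" "\<And>c. scal B c \<in> carrier B"
      "\<And>c. gA (scal A c) = gB (scal B c)"
  shows "equivariantly_isomorphic A (normalization B)"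
proof -
  interpret A: gm_algebra_embedding A gA
    using A by (simp add: gm_algebra_embedding_def)
  interpret B: gm_algebra_embedding B gB
    using B by (simp add: gm_algebra_embedding_def)
  let ?T = "total_fractions B" and ?N = "normalization B"
  interpret T: ring_embedding ?T B.val by (rule B.total_fractions_embedding)
  have carrier_N: "carrier ?N = {x \<in> carrier ?T. integral_over (gB ` carrier B) (B.val x)}"
    using B.integral_closure_total_fractions by (auto simp: normalization_def)
  have ops: "\<And>x y. x \<otimes>\<^bsub>?N\<^esub> y = x \<otimes>\<^bsub>?T\<^esub> y" "\<And>x y. x \<oplus>\<^bsub>?N\<^esub> y = x \<oplus>\<^bsub>?T\<^esub> y"
    "\<one>\<^bsub>?N\<^esub> = \<one>\<^bsub>?T\<^esub>" "torus ?N = torus ?T" "scal ?N = scal ?T"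
    by (simp_all add: normalization_def)
  have A_in: "gA a \<in> B.val ` carrier ?N" if a: "a \<in> carrier A" for a
  proof -
    obtain b s where b: "b \<in> carrier B" "s \<in> carrier B" "gB s \<noteq> 0" "gA a * gB s = gB b"
      using quot [OF a] by blast
    then have s: "s \<in> B.S" by (auto simp: B.non_zero_divisors_iff B.g_zero)
    have "B.val (frac B B.S b s) = gA a"
      using b s by (simp add: B.val_frac field_simps)
    moreover have "frac B B.S b s \<in> carrier ?T"
      using b s by (auto simp: B.frac_in_total_fractions)
    ultimately show ?thesis using int [OF a] unfolding carrier_N by force
  qed
  \<comment> \<open>A fraction over B is one over A, and integrality over B implies integrality over
    A. As A is integrally closed, the element lies in A.\<close>
  have N_in: "B.val U \<in> gA ` carrier A" if U: "U \<in> carrier ?N" for U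
  proof -
    obtain b s where b: "b \<in> carrier B" "s \<in> B.S" "B.val U = gB b / gB s"
      using U B.val_image unfolding carrier_N by blast
    have "gB b \<in> gA ` carrier A" "gB s \<in> gA ` carrier A"
      using b(1) B.S_carrier [OF b(2)] sub by auto
    then obtain a' s' where a': "a' \<in> carrier A" "gB b = gA a'" "s' \<in> carrier A" "gB s = gA s'"
      by (elim imageE)
    have s': "s' \<in> A.S"
      using B.g_S [OF b(2)] a' by (auto simp: A.non_zero_divisors_iff A.g_zero)
    let ?W = "frac A A.S a' s'"
    have W: "A.val ?W = B.val U" "?W \<in> carrier (total_fractions A)"
      using a' b s' by (auto simp: A.val_frac A.frac_in_total_fractions)
    have "integral_over (gA ` carrier A) (B.val U)"
      using U integral_over_mono [OF _ sub] by (auto simp: carrier_N)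
    then have "?W \<in> fractions_image A"
      using W normal A.integral_closure_total_fractions by auto
    then show ?thesis using W A.val_fractions_image by (metis imageI)
  qed
  define \<phi> where "\<phi> a = inv_into (carrier ?N) B.val (gA a)" for a
  have \<phi>: "\<phi> a \<in> carrier ?N" "B.val (\<phi> a) = gA a" if "a \<in> carrier A" for a
    using A_in [OF that] unfolding \<phi>_def by (auto intro: inv_into_into f_inv_into_f)
  have \<phi>T: "\<phi> a \<in> carrier ?T" if "a \<in> carrier A" for a
    using \<phi>(1) [OF that] by (simp add: carrier_N)
  have \<phi>_eqI: "\<phi> a = U" if "a \<in> carrier A" "U \<in> carrier ?T" "gA a = B.val U" for a U
    using T.g_eq_iff [of "\<phi> a" U] that \<phi> \<phi>T by simp
  have "\<phi> \<in> ring_iso A ?N"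
    unfolding ring_iso_def
  proof (intro CollectI conjI)
    show "\<phi> \<in> Ring.ring_hom A ?N"
      by (rule ring_hom_memI, simp add: \<phi>, unfold ops)
        (rule \<phi>_eqI; simp add: \<phi> \<phi>T T.g_mult T.g_add T.g_one A.g_mult A.g_add A.g_one)+
    show "bij_betw \<phi> (carrier A) (carrier ?N)"
    proof (rule bij_betw_imageI)
      show "inj_on \<phi> (carrier A)"
        by (rule inj_onI) (metis \<phi>(2) A.g_eq_iff)
      have "U \<in> \<phi> ` carrier A" if U: "U \<in> carrier ?N" for U
      proof -
        obtain a where "a \<in> carrier A" "B.val U = gA a" using N_in [OF U] by blast
        then show ?thesis using \<phi>_eqI [of a U] U by (auto simp: carrier_N image_iff)
      qed
      then show "\<phi> ` carrier A = carrier ?N" using \<phi> by blast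
    qed
  qed
  moreover have "\<phi> (scal A c) = scal ?N c" for c
  proof -
    have "scal ?T c = frac B B.S (scal B c) \<one>\<^bsub>B\<^esub>"
      by (simp add: total_fractions_def localization_def)
    then show ?thesis
      using scal B.S_one unfolding ops
      by (intro \<phi>_eqI) (simp_all add: B.val_frac B.g_one B.frac_in_total_fractions)
  qed
  moreover have "\<phi> (torus A l a) = torus ?N l (\<phi> a)" if l: "l \<noteq> 0" and a: "a \<in> carrier A" for l a
  proof -
    obtain b s where b: "b \<in> carrier B" "s \<in> B.S" "\<phi> a = frac B B.S b s"
      using \<phi>T [OF a] unfolding B.carrier_total_fractions by blast
    \<comment> \<open>In a domain the non-zero-divisors are the nonzero elements, and
      \<open>torusB_inj\<close> keeps these nonzero; so the action passes to fractions.\<close>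
    have S: "torus B l t \<in> B.S" if "t \<in> B.S" for t
      using that torusB_inj [OF l] ring_hom_closed [OF torusB [OF l]]
      by (auto simp: B.non_zero_divisors_iff)
    have t: "torus ?T l (\<phi> a) = frac B B.S (torus B l b) (torus B l s)"
      unfolding b(3) total_fractions_def
      by (rule B.frac_torus) (use b S torusB [OF l] in auto)
    have "gA a = gB b / gB s" using \<phi>(2) [OF a] b by (simp add: B.val_frac)
    then have "gA a * gB s = gB b" using B.g_S [OF b(2)] by simp
    then have "gA (torus A l a) * gB (torus B l s) = gB (torus B l b)"
      using torus [OF l a b(1)] b(2) B.S_carrier by blast
    then have "gA (torus A l a) = gB (torus B l b) / gB (torus B l s)"
      using B.g_S [OF S [OF b(2)]] by (simp add: field_simps)
    moreover have "torus B l b \<in> carrier B" by (rule ring_hom_closed [OF torusB [OF l] b(1)])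
    ultimately show ?thesis
      using S [OF b(2)] torusA [OF l a] unfolding ops t
      by (intro \<phi>_eqI) (simp_all add: B.val_frac B.frac_in_total_fractions)
  qed
  ultimately show ?thesis unfolding equivariantly_isomorphic_def by blast
qed

section \<open>Dehomogenization and its kernel\<close>

lemma poly_mapping_sum_single:
  "(\<Sum>m \<in> Poly_Mapping.keys p. Poly_Mapping.single m (Poly_Mapping.lookup p m)) = p"
  by (rule poly_mapping_eqI) (auto simp: lookup_sum lookup_single when_def in_keys_iff)

lemma single_sum:
  "Poly_Mapping.single m (sum f J) = (\<Sum>j \<in> J. Poly_Mapping.single m (f j))"
  by (induction J rule: infinite_finite_induct) (simp_all add: single_add)

text \<open>The universal property of a monoid algebra. It yields both the substitution of Laurent
  polynomials for x, y, z, s and the diagonal actions that scale monomials.\<close>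

locale monoid_algebra_hom =
  fixes h :: "'c :: comm_ring_1 \<Rightarrow> 'r :: comm_ring_1" and v :: "'m :: comm_monoid_add \<Rightarrow> 'r"
  assumes h_add: "h (a + b) = h a + h b" and h_mult: "h (a * b) = h a * h b" and h_1: "h 1 = 1"
    and v_add: "v (m + n) = v m * v n" and v_0: "v 0 = 1"
begin

definition eval_at :: "('m \<Rightarrow>\<^sub>0 'c) \<Rightarrow> 'r" where
  "eval_at p = (\<Sum>m \<in> Poly_Mapping.keys p. h (Poly_Mapping.lookup p m) * v m)"

lemma h_0: "h 0 = 0"
  using h_add [of 0 0] by simp

lemma eval_at_superset:
  "finite M \<Longrightarrow> Poly_Mapping.keys p \<subseteq> M \<Longrightarrow>
     eval_at p = (\<Sum>m \<in> M. h (Poly_Mapping.lookup p m) * v m)"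
  unfolding eval_at_def by (rule sum.mono_neutral_left) (auto simp: in_keys_iff h_0)

lemma eval_at_add: "eval_at (p + q) = eval_at p + eval_at q"
proof -
  let ?M = "Poly_Mapping.keys p \<union> Poly_Mapping.keys q"
  have "eval_at r = (\<Sum>m \<in> ?M. h (Poly_Mapping.lookup r m) * v m)" if "r \<in> {p, q, p + q}" for r
    using that Poly_Mapping.keys_add [of p q] by (intro eval_at_superset) auto
  then show ?thesis by (simp add: lookup_add h_add distrib_right sum.distrib)
qed

lemma eval_at_0: "eval_at 0 = 0"
  by (simp add: eval_at_def)

lemma eval_at_single: "eval_at (Poly_Mapping.single m c) = h c * v m"
  using eval_at_superset [of "{m}" "Poly_Mapping.single m c"] by simp

lemma eval_at_1: "eval_at 1 = 1"
  using eval_at_single [of 0 1] by (simp add: h_1 v_0)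

lemma eval_at_sum: "eval_at (sum f I) = (\<Sum>i \<in> I. eval_at (f i))"
  by (induction I rule: infinite_finite_induct) (simp_all add: eval_at_0 eval_at_add)

lemma eval_at_uminus: "eval_at (- p) = - eval_at p"
  using eval_at_add [of p "- p"] by (simp add: eval_at_0 eq_neg_iff_add_eq_0 add.commute)

lemma eval_at_diff: "eval_at (p - q) = eval_at p - eval_at q"
  using eval_at_add [of p "- q"] by (simp add: eval_at_uminus)

lemma eval_at_mult: "eval_at (p * q) = eval_at p * eval_at q"
proof -
  let ?s = "\<lambda>p m. Poly_Mapping.single m (Poly_Mapping.lookup p m)"
  have "p * q = (\<Sum>m \<in> Poly_Mapping.keys p. ?s p m) * (\<Sum>n \<in> Poly_Mapping.keys q. ?s q n)"
    by (simp add: poly_mapping_sum_single)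
  also have "\<dots> = (\<Sum>m \<in> Poly_Mapping.keys p. \<Sum>n \<in> Poly_Mapping.keys q.
      Poly_Mapping.single (m + n) (Poly_Mapping.lookup p m * Poly_Mapping.lookup q n))"
    by (simp add: sum_product mult_single)
  finally have "eval_at (p * q) = (\<Sum>m \<in> Poly_Mapping.keys p. \<Sum>n \<in> Poly_Mapping.keys q.
      h (Poly_Mapping.lookup p m * Poly_Mapping.lookup q n) * v (m + n))"
    by (simp only: eval_at_sum eval_at_single)
  then show ?thesis
    by (simp add: eval_at_def sum_product h_mult v_add mult_ac)
qed

lemma eval_at_power: "eval_at (p ^ n) = eval_at p ^ n"
  by (induction n) (simp_all add: eval_at_1 eval_at_mult)

end

lemma lookup_mapp_mult:
  "Poly_Mapping.lookup (Poly_Mapping.mapp (\<lambda>m c. u m * c) p) m =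
     u m * (Poly_Mapping.lookup p m :: 'c :: comm_ring_1)"
  by (simp add: lookup_mapp in_keys_iff when_def)

lemma mapp_character:
  fixes u :: "'m :: comm_monoid_add \<Rightarrow> 'c :: comm_ring_1"
  assumes u: "u 0 = 1" "\<And>m n. u (m + n) = u m * u n"
  shows mapp_character_add: "Poly_Mapping.mapp (\<lambda>m c. u m * c) (p + q) =
      Poly_Mapping.mapp (\<lambda>m c. u m * c) p + Poly_Mapping.mapp (\<lambda>m c. u m * c) q"
    and mapp_character_mult: "Poly_Mapping.mapp (\<lambda>m c. u m * c) (p * q) =
      Poly_Mapping.mapp (\<lambda>m c. u m * c) p * Poly_Mapping.mapp (\<lambda>m c. u m * c) q"
proof -
  \<comment> \<open>Scaling the coefficient at \<open>m\<close> by a character \<open>u\<close> is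
    the evaluation that sends the monomial of \<open>m\<close> to its multiple by
    \<open>u m\<close>, hence it respects sums and products.\<close>
  interpret monoid_algebra_hom "Poly_Mapping.single 0" "\<lambda>m. Poly_Mapping.single m (u m)"
    using u by unfold_locales (simp_all add: single_add mult_single)
  have eq: "Poly_Mapping.mapp (\<lambda>m c. u m * c) p = eval_at p" for p
  proof -
    have "eval_at p = (\<Sum>m \<in> Poly_Mapping.keys p. Poly_Mapping.single m
        (Poly_Mapping.lookup (Poly_Mapping.mapp (\<lambda>m c. u m * c) p) m))"
      unfolding eval_at_def lookup_mapp_mult by (simp add: mult_single mult.commute)
    also have "\<dots> = Poly_Mapping.mapp (\<lambda>m c. u m * c) p"
      by (rule poly_mapping_eqI)
        (auto simp: lookup_sum lookup_single lookup_mapp_mult when_def in_keys_iff)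
    finally show ?thesis by simp
  qed
  show "Poly_Mapping.mapp (\<lambda>m c. u m * c) (p + q) =
      Poly_Mapping.mapp (\<lambda>m c. u m * c) p + Poly_Mapping.mapp (\<lambda>m c. u m * c) q"
    and "Poly_Mapping.mapp (\<lambda>m c. u m * c) (p * q) =
      Poly_Mapping.mapp (\<lambda>m c. u m * c) p * Poly_Mapping.mapp (\<lambda>m c. u m * c) q"
    by (simp_all only: eq eval_at_add eval_at_mult)
qed

section \<open>Rational functions in t and Laurent polynomials in u\<close>

abbreviation (input) tt :: "complex poly fract" where "tt \<equiv> to_fract [:0, 1:]"

lemma to_fract_const:
  "to_fract [:1 :: complex:] = 1" "to_fract [:a * b :: complex:] = to_fract [:a:] * to_fract [:b:]"
  "to_fract [:a + b :: complex:] = to_fract [:a:] + to_fract [:b:]"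
proof -
  show "to_fract [:1 :: complex:] = 1" by (simp flip: one_pCons)
  show "to_fract [:a * b :: complex:] = to_fract [:a:] * to_fract [:b:]"
    by (subst to_fract_mult [symmetric]) simp
  show "to_fract [:a + b :: complex:] = to_fract [:a:] + to_fract [:b:]"
    by (subst to_fract_add [symmetric]) simp
qed

lemma to_fract_power: "to_fract (p ^ n) = to_fract p ^ n"
  by (induction n) simp_all

lemma to_fract_monom: "to_fract (Polynomial.monom c n) = to_fract [:c:] * tt ^ n" for c :: complex
  by (simp add: monom_altdef flip: to_fract_power to_fract_mult)

lemma to_fract_eq_sum:
  "to_fract p = (\<Sum>i \<le> Polynomial.degree p. to_fract [:Polynomial.coeff p i:] * tt ^ i)"
proof -
  have "p = (\<Sum>i \<le> Polynomial.degree p. [:Polynomial.coeff p i:] * [:0, 1:] ^ i)"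
    using poly_as_sum_of_monoms [of p] by (simp add: monom_altdef)
  then show ?thesis by (metis (no_types, lifting) sum.cong to_fract_mult to_fract_power to_fract_sum)
qed

text \<open>Multiplying by a high power of t turns the relation into one between distinct monomials
  of C[t], whose coefficients can be compared.\<close>

lemma powi_T_independent:
  fixes c :: "'i \<Rightarrow> complex" and e :: "'i \<Rightarrow> nat"
  assumes fin: "finite I" and inj: "inj_on e I"
    and zero: "(\<Sum>i \<in> I. to_fract [:c i:] * tt powi (- int (e i))) = 0" and i: "i \<in> I"
  shows "c i = 0"
proof -
  \<comment> \<open>Any upper bound of the exponents would do; the sum avoids a maximum over a
    possibly empty set.\<close>
  define M where "M = (\<Sum>i \<in> I. e i)"
  have le: "e i \<le> M" if "i \<in> I" for i using that fin by (simp add: M_def member_le_sum)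
  have diff_iff: "M - e j = M - e i \<longleftrightarrow> j = i" if "j \<in> I" for j
  proof
    assume "M - e j = M - e i"
    then have "e j = e i" using le [OF i] le [OF that] by linarith
    then show "j = i" using inj i that by (simp add: inj_on_def)
  qed simp
  have T: "tt powi int M * tt powi (- int (e i)) = tt ^ (M - e i)" if "i \<in> I" for i
  proof -
    have "tt powi int M * tt powi (- int (e i)) = tt powi (int M + - int (e i))"
      by (rule power_int_add [symmetric]) simp
    also have "int M + - int (e i) = int (M - e i)" using le [OF that] by simp
    finally show ?thesis by simp
  qed
  have "0 = tt powi int M * (\<Sum>i \<in> I. to_fract [:c i:] * tt powi (- int (e i)))"
    using zero by simp
  also have "\<dots> = (\<Sum>i \<in> I. to_fract [:c i:] * (tt powi int M * tt powi (- int (e i))))"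
    by (simp add: sum_distrib_left mult_ac)
  also have "\<dots> = (\<Sum>i \<in> I. to_fract [:c i:] * tt ^ (M - e i))"
    by (intro sum.cong) (simp_all only: T)
  also have "\<dots> = to_fract (\<Sum>i \<in> I. Polynomial.monom (c i) (M - e i))"
    by (simp add: to_fract_monom)
  finally have "(\<Sum>i \<in> I. Polynomial.monom (c i) (M - e i)) = 0" by (metis to_fract_eq_0_iff)
  then have "0 = Polynomial.coeff (\<Sum>i \<in> I. Polynomial.monom (c i) (M - e i)) (M - e i)" by simp
  also have "\<dots> = (\<Sum>j \<in> I. if j = i then c j else 0)"
    unfolding Polynomial.coeff_sum
    using diff_iff by (intro sum.cong) simp_all
  also have "\<dots> = c i" using i fin by simp
  finally show ?thesis by simp
qed

type_synonym laurent = "int \<Rightarrow>\<^sub>0 complex poly fract"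

text \<open>The action on all of C(t)[u, 1/u]. Both torus actions are restrictions of it along the
  embeddings, which is how equivariance is checked.\<close>

definition torus_laurent :: "complex \<Rightarrow> laurent \<Rightarrow> laurent" where
  "torus_laurent l = Poly_Mapping.mapp (\<lambda>i f. to_fract [:l powi i:] * f)"

lemma lookup_torus_laurent:
  "Poly_Mapping.lookup (torus_laurent l a) i = to_fract [:l powi i:] * Poly_Mapping.lookup a i"
  by (simp add: torus_laurent_def lookup_mapp in_keys_iff when_def)

lemma torus_laurent_hom:
  assumes "l \<noteq> 0"
  shows torus_laurent_add: "torus_laurent l (a + b) = torus_laurent l a + torus_laurent l b"
    and torus_laurent_mult: "torus_laurent l (a * b) = torus_laurent l a * torus_laurent l b"
  using assms unfolding torus_laurent_def
  by (intro mapp_character; simp add: power_int_add to_fract_const)+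

lemma torus_laurent_single:
  "torus_laurent l (Poly_Mapping.single i f) = Poly_Mapping.single i (to_fract [:l powi i:] * f)"
  by (rule poly_mapping_eqI) (auto simp: lookup_torus_laurent lookup_single when_def)

lemma torus_laurent_0: "torus_laurent l 0 = 0"
  by (rule poly_mapping_eqI) (simp add: lookup_torus_laurent)

lemma torus_laurent_sum:
  "l \<noteq> 0 \<Longrightarrow> torus_laurent l (sum f I) = (\<Sum>i \<in> I. torus_laurent l (f i))"
  by (induction I rule: infinite_finite_induct) (simp_all add: torus_laurent_0 torus_laurent_add)

lemma torus_laurent_eq_0: "l \<noteq> 0 \<Longrightarrow> torus_laurent l a = 0 \<Longrightarrow> a = 0"
  by (auto simp: poly_mapping_eq_iff fun_eq_iff lookup_torus_laurent)

section \<open>Weighted degrees\<close>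

definition wdeg :: "(coord \<Rightarrow> int) \<Rightarrow> (coord \<Rightarrow>\<^sub>0 nat) \<Rightarrow> int" where
  "wdeg w m = (\<Sum>v \<in> {Coord_x, Coord_y, Coord_z, Coord_s}. w v * int (Poly_Mapping.lookup m v))"

lemma weighted_homogeneous_iff: "weighted_homogeneous w n p \<longleftrightarrow> (\<forall>m \<in> Poly_Mapping.keys p. wdeg w m = n)"
  by (simp add: weighted_homogeneous_def wdeg_def)

lemma wdeg_add: "wdeg w (m + n) = wdeg w m + wdeg w n"
  by (simp add: wdeg_def lookup_add algebra_simps)

text \<open>The second term of F involves only s and z, so it has degree 0 for every grading that
  ignores these. This is used with the degree in y, for termination of the reduction, and with the
  torus weights, for invariance of F.\<close>

lemma weighted_homogeneous_s_homog_poly: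
  assumes "u Coord_s = 0" "u Coord_z = 0"
  shows "weighted_homogeneous u 0 (coord_poly Coord_s ^ n * homog_poly d Q)"
proof -
  have mult: "weighted_homogeneous u 0 (a * b)"
    if "weighted_homogeneous u 0 a" "weighted_homogeneous u 0 b" for a b
    using weighted_homogeneous_mult [OF that] by simp
  have power: "weighted_homogeneous u 0 (a ^ n)" if "weighted_homogeneous u 0 a" for a n
    using weighted_homogeneous_power [OF that, of n] by simp
  have "weighted_homogeneous u 0 (coord_poly Coord_s)" "weighted_homogeneous u 0 (coord_poly Coord_z)"
    using weighted_homogeneous_coord [of u] assms by metis+
  then show ?thesis
    unfolding homog_poly_def
    by (intro mult power weighted_homogeneous_sum weighted_homogeneous_const)
qed

text \<open>\<open>epem\<close> is the anti-effectivity of D_+ + D_- at the origin, and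
  \<open>poly Q 0 \<noteq> 0\<close> is D_0(0) = 0.\<close>

locale hypersurface =
  fixes d k :: nat and ep em :: int and Q :: "complex poly"
  assumes d: "d \<ge> 1" and k: "k \<ge> 1" and ep: "0 < ep" "ep \<le> int d" and epem: "0 \<le> ep + em"
    and Q: "Q \<noteq> 0" "poly Q 0 \<noteq> 0"
begin

definition F :: poly_xyzs where "F = hypersurface_poly d k ep em Q"

abbreviation (input) w :: "coord \<Rightarrow> int" where "w \<equiv> weight d k ep em Q"

abbreviation (input) N :: nat where "N \<equiv> Polynomial.degree Q"

definition val_mono :: "(coord \<Rightarrow>\<^sub>0 nat) \<Rightarrow> laurent" where
  "val_mono m = Poly_Mapping.single
     (int (Poly_Mapping.lookup m Coord_x) - int k * int (Poly_Mapping.lookup m Coord_y))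
     (to_fract Q ^ Poly_Mapping.lookup m Coord_y *
      tt powi (- int (Poly_Mapping.lookup m Coord_y) * int N - int (Poly_Mapping.lookup m Coord_z)))"

sublocale monoid_algebra_hom "\<lambda>c. Poly_Mapping.single 0 (to_fract [:c:])" val_mono
proof
  fix m n
  have "tt powi (a + b) = tt powi a * tt powi b" for a b
    by (rule power_int_add) simp
  then have *: "tt powi c = tt powi a * tt powi b" if "c = a + b" for a b c using that by simp
  show "val_mono (m + n) = val_mono m * val_mono n"
    unfolding val_mono_def mult_single lookup_add
    by (subst * [where a = "- int (Poly_Mapping.lookup m Coord_y) * int N - int (Poly_Mapping.lookup m Coord_z)"
          and b = "- int (Poly_Mapping.lookup n Coord_y) * int N - int (Poly_Mapping.lookup n Coord_z)"])
      (simp_all add: algebra_simps power_add)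
qed (simp_all add: single_add mult_single val_mono_def to_fract_const)

lemma eval_at_coord:
  "eval_at (coord_poly Coord_x) = Poly_Mapping.single 1 1"
  "eval_at (coord_poly Coord_y) = Poly_Mapping.single (- int k) (to_fract Q * tt powi (- int N))"
  "eval_at (coord_poly Coord_z) = Poly_Mapping.single 0 (inverse tt)"
  "eval_at (coord_poly Coord_s) = 1"
  by (simp_all add: coord_poly_def eval_at_single val_mono_def lookup_single mult_single h_1)

lemma single_power: "Poly_Mapping.single i f ^ n = (Poly_Mapping.single (int n * i) (f ^ n) :: laurent)"
  by (induction n) (simp_all add: mult_single algebra_simps)

text \<open>With s = 1 and z = 1/t the summands are the terms of Q(t) divided by t^N. The image
  agrees with that of x^k y, which is why F goes to 0.\<close>

lemma eval_at_homog_poly: "eval_at (homog_poly d Q) = Poly_Mapping.single 0 (to_fract Q * tt powi (- int N))"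
proof -
  have T: "(inverse tt) ^ (N - j) = tt ^ j * tt powi (- int N)" if "j \<le> N" for j
  proof -
    have "(inverse tt) ^ (N - j) = tt powi (- int (N - j))"
      by (simp only: power_int_minus power_inverse power_int_of_nat)
    also have "- int (N - j) = int j + - int N" using that by simp
    also have "tt powi (int j + - int N) = tt powi int j * tt powi (- int N)"
      by (rule power_int_add) simp
    finally show ?thesis by simp
  qed
  have "eval_at (homog_poly d Q) =
      (\<Sum>j \<le> N. Poly_Mapping.single 0 (to_fract [:Polynomial.coeff Q j:] * (tt ^ j * tt powi (- int N))))"
    unfolding homog_poly_def eval_at_sum
    by (intro sum.cong)
      (simp_all add: eval_at_mult eval_at_power eval_at_single eval_at_coord v_0 single_power
         mult_single T)
  also have "\<dots> = Poly_Mapping.single 0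
      (\<Sum>j \<le> N. to_fract [:Polynomial.coeff Q j:] * (tt ^ j * tt powi (- int N)))"
    by (rule single_sum [symmetric])
  also have "(\<Sum>j \<le> N. to_fract [:Polynomial.coeff Q j:] * (tt ^ j * tt powi (- int N))) =
      to_fract Q * tt powi (- int N)"
    by (subst to_fract_eq_sum [of Q]) (simp only: sum_distrib_right mult.assoc)
  finally show ?thesis .
qed

lemma eval_at_F: "eval_at F = 0"
  by (simp add: F_def hypersurface_poly_def eval_at_diff eval_at_mult eval_at_power eval_at_coord
      eval_at_homog_poly single_power mult_single)

section \<open>Reduction modulo F and the kernel of the evaluation\<close>

definition normal_form :: "poly_xyzs \<Rightarrow> bool" where
  "normal_form p \<longleftrightarrow> (\<forall>m \<in> Poly_Mapping.keys p.
     Poly_Mapping.lookup m Coord_x < k \<or> Poly_Mapping.lookup m Coord_y = 0)"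

lemma normal_form_sum:
  assumes "\<And>i. i \<in> I \<Longrightarrow> normal_form (f i)"
  shows "normal_form (sum f I)"
  unfolding normal_form_def
proof
  fix m assume "m \<in> Poly_Mapping.keys (sum f I)"
  then obtain i where "i \<in> I" "m \<in> Poly_Mapping.keys (f i)" using keys_sum [of f I] by auto
  then show "Poly_Mapping.lookup m Coord_x < k \<or> Poly_Mapping.lookup m Coord_y = 0"
    using assms unfolding normal_form_def by simp
qed

lemma normal_form_const_mult: "normal_form p \<Longrightarrow> normal_form (Poly_Mapping.single 0 c * p)"
  unfolding normal_form_def mult_map_scale_conv_mult [symmetric]
  by (auto simp: in_keys_iff Poly_Mapping.map.rep_eq when_def split: if_splits)

text \<open>Linear extension of a degree-preserving reduction from monomials to homogeneous
  polynomials. It is needed inside the induction of \<open>reduce_single\<close> as well as for its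
  final use.\<close>

lemma reduce_sum:
  assumes p: "weighted_homogeneous w n p"
    and r: "\<And>m. m \<in> Poly_Mapping.keys p \<Longrightarrow> \<exists>h. let q = Poly_Mapping.single m 1 - h * F in
      weighted_homogeneous w (wdeg w m) q \<and> normal_form q"
  shows "\<exists>h. weighted_homogeneous w n (p - h * F) \<and> normal_form (p - h * F)"
proof -
  let ?c = "Poly_Mapping.lookup p"
  have "\<forall>m \<in> Poly_Mapping.keys p. \<exists>h.
      weighted_homogeneous w n (Poly_Mapping.single m 1 - h * F) \<and>
      normal_form (Poly_Mapping.single m 1 - h * F)"
    using r p unfolding Let_def weighted_homogeneous_iff [of w n p] by fastforce
  then obtain h where h: "\<And>m. m \<in> Poly_Mapping.keys p \<Longrightarrow>
      weighted_homogeneous w n (Poly_Mapping.single m 1 - h m * F)"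
    "\<And>m. m \<in> Poly_Mapping.keys p \<Longrightarrow> normal_form (Poly_Mapping.single m 1 - h m * F)"
    by metis
  let ?h = "\<Sum>m \<in> Poly_Mapping.keys p. Poly_Mapping.single 0 (?c m) * h m"
  have "p - ?h * F = (\<Sum>m \<in> Poly_Mapping.keys p. Poly_Mapping.single m (?c m)) - ?h * F"
    by (simp add: poly_mapping_sum_single)
  also have "\<dots> = (\<Sum>m \<in> Poly_Mapping.keys p.
      Poly_Mapping.single 0 (?c m) * (Poly_Mapping.single m 1 - h m * F))"
    by (simp add: sum_subtractf sum_distrib_right right_diff_distrib mult_single mult.assoc)
  finally have eq: "p - ?h * F = \<dots>" .
  have "weighted_homogeneous w (0 + n) (Poly_Mapping.single 0 (?c m) * (Poly_Mapping.single m 1 - h m * F))"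
    if "m \<in> Poly_Mapping.keys p" for m
    by (intro weighted_homogeneous_mult weighted_homogeneous_const h that)
  then show ?thesis
    unfolding eq [symmetric]
    by (intro exI [of _ ?h], unfold eq)
      (auto intro!: weighted_homogeneous_sum normal_form_sum normal_form_const_mult h)
qed

lemma weighted_homogeneous_F:
  "weighted_homogeneous w (int k * (ep + em) + int d * int N) F"
  unfolding F_def using epem by (rule weighted_homogeneous_hypersurface_poly)

lemma weighted_homogeneous_single: "weighted_homogeneous u (wdeg u m) (Poly_Mapping.single m c)"
  by (simp add: weighted_homogeneous_iff)

text \<open>Induction on the exponent of y. Replacing a factor x^k y by the second term of F lowers
  that exponent by one in every resulting monomial, and homogeneity of F keeps the weighted
  degree.\<close>

lemma reduce_single:
  "\<exists>h. let q = Poly_Mapping.single m 1 - h * F in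
      weighted_homogeneous w (wdeg w m) q \<and> normal_form q"
proof (induction "Poly_Mapping.lookup m Coord_y" arbitrary: m rule: less_induct)
  case less
  show ?case
  proof (cases "Poly_Mapping.lookup m Coord_x < k \<or> Poly_Mapping.lookup m Coord_y = 0")
    case True
    then show ?thesis
      by (intro exI [of _ 0]) (auto simp: normal_form_def weighted_homogeneous_single)
  next
    case False
    define e :: "coord \<Rightarrow>\<^sub>0 nat" where
      "e = Poly_Mapping.single Coord_x k + Poly_Mapping.single Coord_y 1"
    define m1 where "m1 = m - e"
    have m: "m = m1 + e"
    proof (rule poly_mapping_eqI)
      fix v show "Poly_Mapping.lookup m v = Poly_Mapping.lookup (m1 + e) v"
        using False unfolding m1_def e_def
        by (cases v) (auto simp: lookup_add lookup_minus lookup_single)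
    qed
    \<comment> \<open>The monomial of \<open>m\<close> with its factor x^k y rewritten by means of
      F.\<close>
    define G where "G = Poly_Mapping.single m1 1 *
      (coord_poly Coord_s ^ nat (int k * (ep + em)) * homog_poly d Q)"
    have xky: "coord_poly Coord_x ^ k * coord_poly Coord_y = Poly_Mapping.single e 1"
    proof -
      have "coord_poly Coord_x ^ n = Poly_Mapping.single (Poly_Mapping.single Coord_x n) 1" for n
        by (induction n) (simp_all add: coord_poly_def mult_single flip: single_add)
      then show ?thesis by (simp add: e_def coord_poly_def mult_single)
    qed
    have G: "G = Poly_Mapping.single m 1 - Poly_Mapping.single m1 1 * F"
      unfolding F_def hypersurface_poly_def xky G_def
      by (simp add: m right_diff_distrib mult_single)
    have we: "wdeg w m = wdeg w m1 + (int k * (ep + em) + int d * int N)"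
      using epem unfolding m wdeg_add by (simp add: wdeg_def e_def lookup_add lookup_single algebra_simps)
    have G_hom: "weighted_homogeneous w (wdeg w m) G"
      unfolding G
      by (intro weighted_homogeneous_diff weighted_homogeneous_single, unfold we,
          intro weighted_homogeneous_mult weighted_homogeneous_single weighted_homogeneous_F)
    \<comment> \<open>The grading by degree in y: homogeneity of \<open>G\<close> for it gives all
      its monomials the y-exponent of \<open>m1\<close>.\<close>
    define u where "u = (\<lambda>v. if v = Coord_y then 1 else 0 :: int)"
    have "weighted_homogeneous u 0 (coord_poly Coord_s ^ nat (int k * (ep + em)) * homog_poly d Q)"
      by (intro weighted_homogeneous_s_homog_poly) (simp_all add: u_def)
    then have "weighted_homogeneous u (wdeg u m1 + 0) G"
      unfolding G_def by (intro weighted_homogeneous_mult weighted_homogeneous_single)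
    then have G_y: "Poly_Mapping.lookup m' Coord_y = Poly_Mapping.lookup m1 Coord_y"
      if "m' \<in> Poly_Mapping.keys G" for m'
      using that by (auto simp: weighted_homogeneous_iff wdeg_def u_def)
    have "Poly_Mapping.lookup m1 Coord_y < Poly_Mapping.lookup m Coord_y"
      by (simp add: m e_def lookup_add lookup_single)
    then have "\<exists>h. weighted_homogeneous w (wdeg w m) (G - h * F) \<and> normal_form (G - h * F)"
      by (intro reduce_sum [OF G_hom] less) (simp add: G_y)
    then obtain h where "weighted_homogeneous w (wdeg w m) (G - h * F)" "normal_form (G - h * F)"
      by blast
    moreover have "G - h * F = Poly_Mapping.single m 1 - (Poly_Mapping.single m1 1 + h) * F"
      by (simp add: G algebra_simps)
    ultimately show ?thesis by (metis (no_types, lifting))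
  qed
qed

text \<open>Fix one power of u. Its coefficient in the image collects monomials with the same
  exponents of x and y; their images differ only by powers of t coming from z, and these are
  independent.\<close>

lemma normal_form_zero:
  assumes hom: "weighted_homogeneous w n q" and nf: "normal_form q" and zero: "eval_at q = 0"
  shows "q = 0"
proof (rule ccontr)
  assume "q \<noteq> 0"
  then obtain m0 where m0: "m0 \<in> Poly_Mapping.keys q"
    by (metis Poly_Mapping.keys_eq_empty ex_in_conv)
  let ?l = "Poly_Mapping.lookup"
  let ?i = "\<lambda>m. int (?l m Coord_x) - int k * int (?l m Coord_y)"
  define K where "K = {m \<in> Poly_Mapping.keys q. ?i m = ?i m0}"
  have xy: "?l m Coord_x = ?l m0 Coord_x \<and> ?l m Coord_y = ?l m0 Coord_y" if "m \<in> K" for m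
  proof -
    \<comment> \<open>Solutions with the same a - k b differ by multiples of (k, 1). The larger one
      would have x-exponent at least k and positive y-exponent, which a normal form
      excludes.\<close>
    have uniq: "b = b'" if "int a - int k * int b = int a' - int k * int b'" "b \<le> b'"
      "a' < k \<or> b' = 0" for a b a' b' :: nat
    proof (rule ccontr)
      assume "b \<noteq> b'"
      then have "b < b'" "a' < k" using that by auto
      then have "int k * 1 \<le> int k * (int b' - int b)" by (intro mult_left_mono) auto
      then show False using that(1) \<open>a' < k\<close> by (simp add: algebra_simps)
    qed
    have "?l m Coord_x < k \<or> ?l m Coord_y = 0" "?l m0 Coord_x < k \<or> ?l m0 Coord_y = 0"
      using nf m0 that unfolding normal_form_def K_def by auto
    moreover have "?i m = ?i m0" using that by (simp add: K_def)
    ultimately have "?l m Coord_y = ?l m0 Coord_y"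
      using uniq [of "?l m Coord_x" "?l m Coord_y" "?l m0 Coord_x" "?l m0 Coord_y"]
        uniq [of "?l m0 Coord_x" "?l m0 Coord_y" "?l m Coord_x" "?l m Coord_y"]
      by (metis nat_le_linear)
    then show ?thesis using \<open>?i m = ?i m0\<close> by simp
  qed
  \<comment> \<open>The factor contributed by y is common to all monomials in \<open>K\<close>, and
    it is nonzero.\<close>
  let ?C = "to_fract Q ^ ?l m0 Coord_y * tt powi (- int (?l m0 Coord_y) * int N)"
  have "0 = ?l (eval_at q) (?i m0)" by (simp add: zero)
  also have "\<dots> = (\<Sum>m \<in> Poly_Mapping.keys q. if ?i m = ?i m0 then to_fract [:?l q m:] *
      (to_fract Q ^ ?l m Coord_y * tt powi (- int (?l m Coord_y) * int N - int (?l m Coord_z))) else 0)"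
    unfolding eval_at_def lookup_sum
    by (intro sum.cong) (auto simp: val_mono_def mult_single lookup_single)
  also have "\<dots> = (\<Sum>m \<in> K. to_fract [:?l q m:] *
      (to_fract Q ^ ?l m Coord_y * tt powi (- int (?l m Coord_y) * int N - int (?l m Coord_z))))"
    unfolding K_def by (simp add: sum.If_cases Int_def conj_commute)
  also have "\<dots> = (\<Sum>m \<in> K. ?C * (to_fract [:?l q m:] * tt powi (- int (?l m Coord_z))))"
  proof (rule sum.cong [OF refl])
    fix m assume m: "m \<in> K"
    have "tt powi (- int (?l m0 Coord_y) * int N + - int (?l m Coord_z)) =
        tt powi (- int (?l m0 Coord_y) * int N) * tt powi (- int (?l m Coord_z))"
      by (rule power_int_add) simp
    then show "to_fract [:?l q m:] * (to_fract Q ^ ?l m Coord_y *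
          tt powi (- int (?l m Coord_y) * int N - int (?l m Coord_z))) =
        ?C * (to_fract [:?l q m:] * tt powi (- int (?l m Coord_z)))"
      using xy [OF m] by simp
  qed
  also have "\<dots> = ?C * (\<Sum>m \<in> K. to_fract [:?l q m:] * tt powi (- int (?l m Coord_z)))"
    by (rule sum_distrib_left [symmetric])
  finally have "(\<Sum>m \<in> K. to_fract [:?l q m:] * tt powi (- int (?l m Coord_z))) = 0"
    using Q by (simp add: power_int_eq_0_iff)
  \<comment> \<open>Homogeneity is decisive here: since s has weight 1, the total degree and the
    exponents of x, y and z determine the exponent of s, which the evaluation forgets.\<close>
  moreover have "inj_on (\<lambda>m. ?l m Coord_z) K"
  proof (rule inj_onI)
    fix m m' assume m: "m \<in> K" "m' \<in> K" "?l m Coord_z = ?l m' Coord_z"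
    have "wdeg w m = n" "wdeg w m' = n"
      using m hom by (auto simp: weighted_homogeneous_iff K_def)
    then have "?l m Coord_s = ?l m' Coord_s"
      using m xy [of m] xy [of m'] by (simp add: wdeg_def)
    then have "?l m v = ?l m' v" for v using m xy [of m] xy [of m'] by (cases v) auto
    then show "m = m'" by (rule poly_mapping_eqI)
  qed
  ultimately have "?l q m0 = 0"
    using m0 by (intro powi_T_independent [of K "\<lambda>m. ?l m Coord_z"]) (auto simp: K_def)
  then show False using m0 by (simp add: in_keys_iff)
qed

lemma eval_at_kernel:
  assumes "weighted_homogeneous w n p" and "eval_at p = 0"
  shows "\<exists>h. p = h * F"
proof -
  obtain h where h: "weighted_homogeneous w n (p - h * F)" "normal_form (p - h * F)"
    using reduce_sum [OF assms(1) reduce_single] by blast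
  have "eval_at (p - h * F) = 0" using assms by (simp add: eval_at_diff eval_at_mult eval_at_F)
  then have "p - h * F = 0" by (rule normal_form_zero [OF h])
  then show ?thesis by auto
qed

end

section \<open>Comparison of the two rings inside the Laurent polynomials\<close>

lemma fract_cases_nonzero:
  fixes f :: "complex poly fract"
  assumes "f \<noteq> 0"
  obtains a b where "a \<noteq> 0" "b \<noteq> 0" "f = to_fract a / to_fract b"
  using assms to_fract_quot_of_fract [of f] that
    [of "fst (quot_of_fract f)" "snd (quot_of_fract f)"]
  by (simp flip: Fract_conv_to_fract)

text \<open>The order is defined through the reduced fraction; cross-multiplying shows that any
  representation gives the same difference. Additivity then follows from that for
  polynomials.\<close>

lemma order_at_divide:
  assumes "a \<noteq> 0" "b \<noteq> 0"
  shows "order_at p (to_fract a / to_fract b) =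
    int (Polynomial.order p a) - int (Polynomial.order p b)"
proof -
  let ?f = "to_fract a / to_fract b"
  define a' b' where "a' = fst (quot_of_fract ?f)" and "b' = snd (quot_of_fract ?f)"
  have nz: "a' \<noteq> 0" "b' \<noteq> 0" using assms by (simp_all add: a'_def b'_def)
  have "to_fract a' / to_fract b' = ?f"
    by (simp add: a'_def b'_def flip: Fract_conv_to_fract)
  then have "to_fract (a' * b) = to_fract (a * b')"
    using assms nz by (simp add: field_simps)
  then have "a' * b = a * b'" by (simp only: to_fract_eq_iff)
  then have "Polynomial.order p (a' * b) = Polynomial.order p (a * b')" by simp
  then have "Polynomial.order p a' + Polynomial.order p b = Polynomial.order p a + Polynomial.order p b'"
    using assms nz by (simp add: Polynomial.order_mult)
  then show ?thesis unfolding order_at_def a'_def [symmetric] b'_def [symmetric] by linarith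
qed

lemma order_at_to_fract: "a \<noteq> 0 \<Longrightarrow> order_at p (to_fract a) = int (Polynomial.order p a)"
  using order_at_divide [of a 1 p] by simp

lemma order_at_mult:
  assumes "f \<noteq> 0" "g \<noteq> 0"
  shows "order_at p (f * g) = order_at p f + order_at p g"
proof -
  obtain a b where f: "a \<noteq> 0" "b \<noteq> 0" "f = to_fract a / to_fract b"
    using fract_cases_nonzero [OF assms(1)] by blast
  obtain c e where g: "c \<noteq> 0" "e \<noteq> 0" "g = to_fract c / to_fract e"
    using fract_cases_nonzero [OF assms(2)] by blast
  have fg: "f * g = to_fract (a * c) / to_fract (b * e)" by (simp add: f g)
  show ?thesis
    unfolding fg using f g by (simp add: order_at_divide Polynomial.order_mult del: to_fract_mult)
qed

lemma order_at_1: "order_at p 1 = 0"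
  using order_at_to_fract [of 1 p] by simp

lemma order_at_power: "f \<noteq> 0 \<Longrightarrow> order_at p (f ^ n) = int n * order_at p f"
  by (induction n) (simp_all add: order_at_1 order_at_mult algebra_simps)

lemma order_at_inverse: "f \<noteq> 0 \<Longrightarrow> order_at p (inverse f) = - order_at p f"
  using order_at_mult [of f "inverse f" p] by (simp add: order_at_1)

lemma order_at_powi: "f \<noteq> 0 \<Longrightarrow> order_at p (f powi j) = j * order_at p f"
  by (auto simp: power_int_def order_at_power order_at_inverse)

lemma order_at_T_powi: "order_at p (tt powi j) = (if p = 0 then j else 0)"
proof -
  have "Polynomial.order p [:0, 1:] = (if p = 0 then 1 else 0)"
    using order_power_n_n [of "0 :: complex" 1] by (auto intro!: Polynomial.order_0I)
  then have "order_at p tt = (if p = 0 then 1 else 0)" by (simp add: order_at_to_fract)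
  then show ?thesis by (simp add: order_at_powi)
qed

lemma order_at_const: "c \<noteq> 0 \<Longrightarrow> order_at p (to_fract [:c:]) = 0"
  by (simp add: order_at_to_fract Polynomial.order_0I)

text \<open>A nonconstant reduced denominator would have a root over the complex numbers, where the
  coprime numerator does not vanish, so the order there would be negative.\<close>

lemma to_fract_of_order_at_nonneg:
  assumes f: "f \<noteq> 0" and order: "\<And>p. order_at p f \<ge> 0"
  obtains a where "f = to_fract a"
proof -
  define a b where "a = fst (quot_of_fract f)" and "b = snd (quot_of_fract f)"
  have nz: "a \<noteq> 0" "b \<noteq> 0" using f by (simp_all add: a_def b_def)
  have f_eq: "f = to_fract a / to_fract b"
    by (simp add: a_def b_def flip: Fract_conv_to_fract)
  have cop: "coprime a b" unfolding a_def b_def by (rule coprime_quot_of_fract)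
  have "poly b p \<noteq> 0" for p
  proof
    assume "poly b p = 0"
    then have "Polynomial.order p b > 0" using nz by (simp add: Polynomial.order_gt_0_iff)
    moreover have "Polynomial.order p a \<ge> Polynomial.order p b"
      using order [of p] nz by (simp add: f_eq order_at_divide)
    ultimately have "Polynomial.order p a > 0" by linarith
    then have "poly a p = 0" using nz by (simp add: Polynomial.order_gt_0_iff)
    then have "[:- p, 1:] dvd a" "[:- p, 1:] dvd b"
      using \<open>poly b p = 0\<close> by (simp_all add: poly_eq_0_iff_dvd)
    then have "is_unit [:- p, 1:]" using cop by (meson coprime_common_divisor)
    then show False by (simp add: is_unit_iff_degree)
  qed
  then have "Polynomial.degree b = 0"
    using fundamental_theorem_of_algebra [of b] constant_degree [of b] by blast
  then obtain c where c: "b = [:c:]" "c \<noteq> 0" using nz by (auto elim!: degree_eq_zeroE)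
  have "to_fract (smult (inverse c) a) * to_fract b = to_fract a"
    using c by (simp flip: to_fract_mult)
  then have "f = to_fract (smult (inverse c) a)" using nz by (simp add: f_eq field_simps)
  then show ?thesis by (rule that)
qed

section \<open>The graded pieces of A as inequalities between orders\<close>

lemma lookup_rat_div: "Poly_Mapping.lookup (rat_div D) p = of_int (Poly_Mapping.lookup D p)"
  by (simp add: rat_div_def Poly_Mapping.map.rep_eq when_def)

lemma lookup_scale_div: "Poly_Mapping.lookup (scale_div r D) p = r * Poly_Mapping.lookup D p"
  by (simp add: scale_div_def Poly_Mapping.map.rep_eq when_def)

lemma lookup_princ_div: "f \<noteq> 0 \<Longrightarrow> Poly_Mapping.lookup (princ_div f) p = order_at p f"
  by (simp add: princ_div.rep_eq)

lemma zero_in_dpd_piece: "0 \<in> dpd_piece D E i"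
  by (simp add: dpd_piece_def)

lemma dpd_algebra_simps:
  "carrier (dpd_algebra D E) = {a. \<forall>i. Poly_Mapping.lookup a i \<in> dpd_piece D E i}"
  "x \<otimes>\<^bsub>dpd_algebra D E\<^esub> y = x * y" "x \<oplus>\<^bsub>dpd_algebra D E\<^esub> y = x + y"
  "\<one>\<^bsub>dpd_algebra D E\<^esub> = 1" "\<zero>\<^bsub>dpd_algebra D E\<^esub> = 0"
  "scal (dpd_algebra D E) c = Poly_Mapping.single 0 (to_fract [:c:])"
  "torus (dpd_algebra D E) = torus_laurent"
  by (simp_all add: dpd_algebra_def ring.defs gm_algebra.defs ring_of_type_algebra_def
      torus_laurent_def fun_eq_iff)

lemma single_in_dpd_algebra_iff:
  "Poly_Mapping.single i f \<in> carrier (dpd_algebra D E) \<longleftrightarrow> f \<in> dpd_piece D E i"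
  by (auto simp: dpd_algebra_simps lookup_single when_def zero_in_dpd_piece)

lemma rat_ineq:
  assumes "n \<ge> 1"
  shows "0 \<le> of_int o' + of_int i * - (of_int e / of_nat n :: rat) \<longleftrightarrow> i * e \<le> int n * o'"
proof -
  have "0 \<le> of_int o' + of_int i * - (of_int e / of_nat n :: rat) \<longleftrightarrow>
      (of_int i * of_int e :: rat) \<le> of_nat n * of_int o'"
    using assms by (simp add: field_simps)
  also have "\<dots> \<longleftrightarrow> (of_int (i * e) :: rat) \<le> of_int (int n * o')" by simp
  finally show ?thesis by (simp only: of_int_le_iff)
qed

context hypersurface
begin

abbreviation (input) Dp :: "complex \<Rightarrow>\<^sub>0 rat" where
  "Dp \<equiv> Poly_Mapping.single 0 (- (of_int ep / of_nat d))"

abbreviation (input) Dm :: "complex \<Rightarrow>\<^sub>0 rat" where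
  "Dm \<equiv> Poly_Mapping.single 0 (- (of_int em / of_nat d)) -
     scale_div (1 / of_nat k) (rat_div (princ_div (to_fract Q)))"

abbreviation (input) A where "A \<equiv> dpd_algebra Dp Dm"

lemma order_at_0_Q: "order_at 0 (to_fract Q) = 0"
  using Q by (simp add: order_at_to_fract Polynomial.order_0I)

lemma order_at_Q_nonneg: "0 \<le> order_at p (to_fract Q)"
  using Q by (simp add: order_at_to_fract)

lemma dpd_piece_nonneg_iff:
  assumes "f \<noteq> 0" "i \<ge> 0"
  shows "f \<in> dpd_piece Dp Dm i \<longleftrightarrow> (\<forall>p. (if p = 0 then i * ep else 0) \<le> int d * order_at p f)"
proof -
  have "0 \<le> of_int (order_at p f) + of_int i * Poly_Mapping.lookup Dp p \<longleftrightarrow>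
      (if p = 0 then i * ep else 0) \<le> int d * order_at p f" for p
    using rat_ineq [OF d, of "order_at p f" i ep] d
    by (auto simp: lookup_single when_def zero_le_mult_iff)
  then show ?thesis
    using assms by (simp add: dpd_piece_def effective_def lookup_add lookup_rat_div
        lookup_scale_div lookup_princ_div)
qed

text \<open>Since Q(0) is nonzero, the two summands of D_- have disjoint supports: only the
  denominator d occurs at 0 and only k elsewhere, so each inequality is cleared separately.\<close>

lemma dpd_piece_neg_iff:
  assumes "f \<noteq> 0" "i < 0"
  shows "f \<in> dpd_piece Dp Dm i \<longleftrightarrow> - i * em \<le> int d * order_at 0 f \<and>
    (\<forall>p. p \<noteq> 0 \<longrightarrow> - i * order_at p (to_fract Q) \<le> int k * order_at p f)"
proof -
  have "0 \<le> of_int (order_at p f) + of_int (- i) * Poly_Mapping.lookup Dm p \<longleftrightarrow>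
      (if p = 0 then - i * em \<le> int d * order_at 0 f
       else - i * order_at p (to_fract Q) \<le> int k * order_at p f)" for p
  proof (cases "p = 0")
    case True
    have "Poly_Mapping.lookup Dm 0 = - (of_int em / of_nat d)"
      using Q by (simp add: lookup_minus lookup_scale_div lookup_rat_div lookup_princ_div order_at_0_Q)
    then show ?thesis using rat_ineq [OF d, of "order_at 0 f" "- i" em] True by (simp only: if_True simp_thms)
  next
    case False
    have "Poly_Mapping.lookup Dm p = - (of_int (order_at p (to_fract Q)) / of_nat k)"
      using Q False
      by (simp add: lookup_minus lookup_single lookup_scale_div lookup_rat_div lookup_princ_div)
    then show ?thesis
      using rat_ineq [OF k, of "order_at p f" "- i" "order_at p (to_fract Q)"] False
      by (simp only: if_False simp_thms)
  qed
  then show ?thesis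
    using assms by (auto simp: dpd_piece_def effective_def lookup_add lookup_rat_div
        lookup_scale_div lookup_princ_div)
qed

text \<open>The image of the chart: p / z^n has degree 0 exactly when p has degree n d, and 1 / z
  becomes t.\<close>

definition B_set :: "laurent set" where
  "B_set = {eval_at p * Poly_Mapping.single 0 (tt ^ n) | p n. weighted_homogeneous w (int n * int d) p}"

lemma eval_at_z_power:
  "eval_at (coord_poly Coord_z ^ n) = Poly_Mapping.single 0 (inverse tt ^ n)"
  by (simp add: eval_at_power eval_at_coord single_power)

lemma eval_at_z_power_inverse:
  "eval_at (coord_poly Coord_z ^ n) * Poly_Mapping.single 0 (tt ^ n) = 1"
  by (simp add: eval_at_z_power mult_single flip: power_mult_distrib)

lemma weighted_homogeneous_z_power: "weighted_homogeneous w (int n * int d) (coord_poly Coord_z ^ n)"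
  using weighted_homogeneous_power [OF weighted_homogeneous_coord [of w Coord_z], of n] by simp

text \<open>Subtraction over the common denominator z^(n + m). It serves closure of
  \<open>B_set\<close>, additivity on the chart and injectivity of the evaluation.\<close>

lemma B_set_diff_aux:
  "eval_at (p * coord_poly Coord_z ^ m - q * coord_poly Coord_z ^ n) * Poly_Mapping.single 0 (tt ^ (n + m)) =
   eval_at p * Poly_Mapping.single 0 (tt ^ n) - eval_at q * Poly_Mapping.single 0 (tt ^ m)"
proof -
  let ?z = "\<lambda>n. eval_at (coord_poly Coord_z ^ n)" and ?t = "\<lambda>n. Poly_Mapping.single 0 (tt ^ n) :: laurent"
  have "?t (n + m) = ?t n * ?t m" by (simp add: mult_single power_add)
  then have "eval_at (p * coord_poly Coord_z ^ m - q * coord_poly Coord_z ^ n) * ?t (n + m) =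
      eval_at p * ?t n * (?z m * ?t m) - eval_at q * ?t m * (?z n * ?t n)"
    by (simp add: eval_at_diff eval_at_mult algebra_simps)
  then show ?thesis by (simp add: eval_at_z_power_inverse)
qed

lemma subring_of_B_set: "subring_of B_set"
  unfolding subring_of_def
proof (intro conjI ballI)
  have "(1 :: laurent) = eval_at 1 * Poly_Mapping.single 0 (tt ^ 0)" by (simp add: eval_at_1)
  moreover have "weighted_homogeneous w (int 0 * int d) 1"
    using weighted_homogeneous_const [of w 1] by simp
  ultimately show "1 \<in> B_set" unfolding B_set_def by blast
  fix a b assume "a \<in> B_set" "b \<in> B_set"
  then obtain p n q m where p: "weighted_homogeneous w (int n * int d) p"
      "a = eval_at p * Poly_Mapping.single 0 (tt ^ n)"
    and q: "weighted_homogeneous w (int m * int d) q"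
      "b = eval_at q * Poly_Mapping.single 0 (tt ^ m)"
    unfolding B_set_def by blast
  have deg: "int n * int d + int m * int d = int (n + m) * int d" by (simp add: algebra_simps)
  have "a * b = eval_at (p * q) * Poly_Mapping.single 0 (tt ^ (n + m))"
    by (simp add: p q eval_at_mult power_add mult_single mult_ac
        flip: mult_single [of 0 _ 0, simplified])
  moreover have "weighted_homogeneous w (int (n + m) * int d) (p * q)"
    using weighted_homogeneous_mult [OF p(1) q(1)] by (simp only: deg)
  ultimately show "a * b \<in> B_set" unfolding B_set_def by blast
  have "a - b = eval_at (p * coord_poly Coord_z ^ m - q * coord_poly Coord_z ^ n) *
      Poly_Mapping.single 0 (tt ^ (n + m))"
    by (simp only: p q B_set_diff_aux)
  moreover have "weighted_homogeneous w (int (n + m) * int d)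
      (p * coord_poly Coord_z ^ m - q * coord_poly Coord_z ^ n)"
    using weighted_homogeneous_mult [OF p(1) weighted_homogeneous_z_power [of m]]
      weighted_homogeneous_mult [OF q(1) weighted_homogeneous_z_power [of n]]
    by (intro weighted_homogeneous_diff) (simp_all add: algebra_simps)
  ultimately show "a - b \<in> B_set" unfolding B_set_def by blast
qed

text \<open>The image of x^a y^b s^c z^(-j - b N). The exponent c leaves no trace; it reappears as
  the slack in the degree condition on \<open>j\<close>.\<close>

definition mono_xys :: "nat \<Rightarrow> nat \<Rightarrow> int \<Rightarrow> laurent" where
  "mono_xys a b j =
     Poly_Mapping.single (int a - int k * int b) (to_fract Q ^ b * tt powi j)"

lemma val_mono_T_power:
  "val_mono m * Poly_Mapping.single 0 (tt ^ n) =
   mono_xys (Poly_Mapping.lookup m Coord_x) (Poly_Mapping.lookup m Coord_y)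
     (int n - int (Poly_Mapping.lookup m Coord_y) * int N - int (Poly_Mapping.lookup m Coord_z))"
proof -
  let ?e = "- int (Poly_Mapping.lookup m Coord_y) * int N - int (Poly_Mapping.lookup m Coord_z)"
  have "tt powi ?e * tt ^ n = tt powi (?e + int n)"
    by (subst power_int_add) simp_all
  also have "?e + int n = int n - int (Poly_Mapping.lookup m Coord_y) * int N -
      int (Poly_Mapping.lookup m Coord_z)" by simp
  finally show ?thesis by (simp add: val_mono_def mono_xys_def mult_single mult.assoc)
qed

text \<open>The hypothesis says that x^a y^b s^c z^(-j - b N) has weighted degree 0; the
  contributions d b N of y and z cancel.\<close>

lemma mono_xys_in_B_set:
  assumes j: "int d * j = int a * ep + int k * int b * em + int c"
  shows "mono_xys a b j \<in> B_set"
proof -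
  \<comment> \<open>The exponent of z may have either sign: \<open>n\<close> is its part in the
    denominator, \<open>mz\<close> the part in the numerator.\<close>
  define n mz where "n = nat (j + int b * int N)" and "mz = nat (- (j + int b * int N))"
  have nm: "int n - int mz = j + int b * int N" by (simp add: n_def mz_def)
  define m where "m = Poly_Mapping.single Coord_x a + Poly_Mapping.single Coord_y b +
    Poly_Mapping.single Coord_z mz + Poly_Mapping.single Coord_s c"
  have m: "Poly_Mapping.lookup m Coord_x = a" "Poly_Mapping.lookup m Coord_y = b"
    "Poly_Mapping.lookup m Coord_z = mz" "Poly_Mapping.lookup m Coord_s = c"
    by (simp_all add: m_def lookup_add lookup_single)
  have "eval_at (Poly_Mapping.single m 1) * Poly_Mapping.single 0 (tt ^ n) = mono_xys a b j"
  proof -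
    have "int n - int b * int N - int mz = j" using nm by simp
    then show ?thesis by (simp add: eval_at_single to_fract_const val_mono_T_power m)
  qed
  moreover have "int n * int d = (j + int b * int N + int mz) * int d" using nm by simp
  then have "weighted_homogeneous w (int n * int d) (Poly_Mapping.single m 1)"
    using j by (simp add: weighted_homogeneous_iff wdeg_def m algebra_simps)
  ultimately show ?thesis unfolding B_set_def by (metis (mono_tags, lifting) mem_Collect_eq)
qed

lemma const_in_B_set: "Poly_Mapping.single 0 (to_fract [:c:]) \<in> B_set"
proof -
  have "Poly_Mapping.single 0 (to_fract [:c:]) =
      eval_at (Poly_Mapping.single 0 c) * Poly_Mapping.single 0 (tt ^ 0)"
    by (simp add: eval_at_single v_0)
  moreover have "weighted_homogeneous w (int 0 * int d) (Poly_Mapping.single 0 c)"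
    using weighted_homogeneous_const [of w c] by simp
  ultimately show ?thesis unfolding B_set_def by blast
qed

lemma poly_in_B_set: "Poly_Mapping.single 0 (to_fract p) \<in> B_set"
proof -
  note B = subring_of_B_set
  have T: "Poly_Mapping.single 0 (tt ^ i) \<in> B_set" for i
    using mono_xys_in_B_set [of "int i" 0 0 "d * i"] by (simp add: mono_xys_def)
  have eq: "Poly_Mapping.single 0 (to_fract p) = (\<Sum>i \<le> Polynomial.degree p.
      Poly_Mapping.single 0 (to_fract [:Polynomial.coeff p i:]) * Poly_Mapping.single 0 (tt ^ i))"
    by (subst to_fract_eq_sum) (simp add: single_sum mult_single)
  show ?thesis
    unfolding eq by (rule subring_of_sum [OF B], rule subring_of_mult [OF B const_in_B_set T])
qed

text \<open>This is the i-th power of t u = x s^(d - e_+) / z, where e_+ \<le> d makes the exponent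
  of s nonnegative.\<close>

lemma tu_power_in_B_set: "Poly_Mapping.single (int i) (tt ^ i) \<in> B_set"
proof -
  have "int d * int i = int i * ep + int k * int 0 * em + int (nat (int d - ep) * i)"
    using ep by (simp add: algebra_simps)
  from mono_xys_in_B_set [OF this] show ?thesis by (simp add: mono_xys_def)
qed

text \<open>Write f = p / q and let n be the absolute value of i. For i \<ge> 0 the denominator q
  t^n leaves p (t u)^n; for i < 0 the denominator q (t u)^n leaves p t^n.\<close>

lemma quotient_of_B_set_single:
  "\<exists>s \<in> B_set. s \<noteq> 0 \<and> Poly_Mapping.single i f * s \<in> B_set"
proof -
  note B = subring_of_B_set
  have "Fract (fst (quot_of_fract f)) (snd (quot_of_fract f)) = f" by simp
  then obtain p q where q: "q \<noteq> 0" "f = to_fract p / to_fract q"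
    using snd_quot_of_fract_nonzero unfolding Fract_conv_to_fract by metis
  define n where "n = nat \<bar>i\<bar>"
  show ?thesis
  proof (cases "i \<ge> 0")
    case True
    let ?s = "Poly_Mapping.single 0 (to_fract (q * [:0, 1:] ^ n))"
    have "Poly_Mapping.single i f * ?s =
        Poly_Mapping.single 0 (to_fract p) * Poly_Mapping.single (int n) (tt ^ n)"
      using True q by (simp add: mult_single n_def to_fract_power)
    then have "Poly_Mapping.single i f * ?s \<in> B_set"
      by (auto intro: subring_of_mult [OF B] poly_in_B_set tu_power_in_B_set)
    moreover have "?s \<noteq> 0"
      using q by (simp add: to_fract_power poly_mapping_eq_iff fun_eq_iff lookup_single when_def)
    ultimately show ?thesis using poly_in_B_set by blast
  next
    case False
    let ?s = "Poly_Mapping.single 0 (to_fract q) * Poly_Mapping.single (int n) (tt ^ n)"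
    have "Poly_Mapping.single i f * ?s = Poly_Mapping.single 0 (to_fract (p * [:0, 1:] ^ n))"
      using False q by (simp add: mult_single n_def to_fract_power)
    then have "Poly_Mapping.single i f * ?s \<in> B_set" by (simp only: poly_in_B_set)
    moreover have "?s \<noteq> 0"
      using q by (simp add: mult_single poly_mapping_eq_iff fun_eq_iff lookup_single when_def)
    moreover have "?s \<in> B_set" by (intro subring_of_mult [OF B] poly_in_B_set tu_power_in_B_set)
    ultimately show ?thesis by blast
  qed
qed

lemma quotient_of_B_set: "\<exists>s \<in> B_set. s \<noteq> 0 \<and> a * s \<in> B_set"
proof -
  note B = subring_of_B_set
  have sum: "\<exists>s \<in> B_set. s \<noteq> 0 \<and> (\<Sum>i \<in> I. g i) * s \<in> B_set"
    if "\<And>i. i \<in> I \<Longrightarrow> \<exists>s \<in> B_set. s \<noteq> 0 \<and> g i * s \<in> B_set" for g :: "int \<Rightarrow> laurent" and I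
    using that
  proof (induction I rule: infinite_finite_induct)
    case (insert i I)
    obtain s where s: "s \<in> B_set" "s \<noteq> 0" "g i * s \<in> B_set" using insert.prems by blast
    obtain r where r: "r \<in> B_set" "r \<noteq> 0" "sum g I * r \<in> B_set" using insert by blast
    have "sum g (insert i I) * (s * r) = (g i * s) * r + (sum g I * r) * s"
      using insert by (simp add: algebra_simps)
    then have "sum g (insert i I) * (s * r) \<in> B_set"
      using s r by (simp add: subring_of_add [OF B] subring_of_mult [OF B])
    then show ?case using s r by (intro bexI [of _ "s * r"]) (auto intro: subring_of_mult [OF B])
  qed (auto intro!: bexI [of _ 1] simp: subring_of_0 [OF B] subring_of_1 [OF B])
  show ?thesis
    using sum [of "Poly_Mapping.keys a" "\<lambda>i. Poly_Mapping.single i (Poly_Mapping.lookup a i)"]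
      quotient_of_B_set_single by (simp add: poly_mapping_sum_single)
qed

text \<open>The degree condition gives d j - i e_+ = k b (e_+ + e_-) + c and d j + i e_- = a (e_+ +
  e_-) + c for i = a - k b. Both are nonnegative, which is the condition at 0; elsewhere Q^b has
  enough zeros.\<close>

lemma mono_xys_in_A:
  assumes j: "int d * j = int a * ep + int k * int b * em + int c"
  shows "mono_xys a b j \<in> carrier A"
proof -
  let ?i = "int a - int k * int b" and ?f = "to_fract Q ^ b * tt powi j"
  have nz: "?f \<noteq> 0" using Q by simp
  have order: "order_at p ?f = int b * order_at p (to_fract Q) + (if p = 0 then j else 0)" for p
    using Q by (simp add: order_at_mult order_at_power order_at_T_powi)
  have "?f \<in> dpd_piece Dp Dm ?i"
  proof (cases "?i \<ge> 0")
    case True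
    have "0 \<le> int k * int b * (ep + em)" using epem by simp
    then have "?i * ep \<le> int d * j" unfolding j by (simp add: algebra_simps)
    then show ?thesis
      using order_at_Q_nonneg by (simp add: dpd_piece_nonneg_iff [OF nz True] order order_at_0_Q)
  next
    case False
    then have i: "?i < 0" by simp
    have "0 \<le> int a * (ep + em)" using epem by simp
    then have "- ?i * em \<le> int d * j" unfolding j by (simp add: algebra_simps)
    moreover have "- ?i * order_at p (to_fract Q) \<le> int k * (int b * order_at p (to_fract Q))" for p
      using order_at_Q_nonneg [of p] by (simp add: algebra_simps)
    ultimately show ?thesis by (simp add: dpd_piece_neg_iff [OF nz i] order order_at_0_Q)
  qed
  then show ?thesis by (simp add: mono_xys_def single_in_dpd_algebra_iff)
qed

lemma const_in_A: "Poly_Mapping.single 0 (to_fract [:c:]) \<in> carrier A"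
  unfolding single_in_dpd_algebra_iff
  by (cases "c = 0") (simp_all add: zero_in_dpd_piece dpd_piece_nonneg_iff order_at_const)

lemma B_set_subset:
  assumes A: "subring_of (carrier A)"
  shows "B_set \<subseteq> carrier A"
proof
  fix a assume "a \<in> B_set"
  then obtain p n where p: "weighted_homogeneous w (int n * int d) p"
    and a: "a = eval_at p * Poly_Mapping.single 0 (tt ^ n)"
    unfolding B_set_def by blast
  have "a = (\<Sum>m \<in> Poly_Mapping.keys p. Poly_Mapping.single 0 (to_fract [:Poly_Mapping.lookup p m:]) *
      (val_mono m * Poly_Mapping.single 0 (tt ^ n)))"
    unfolding a eval_at_def by (simp add: sum_distrib_right mult.assoc)
  also have "\<dots> \<in> carrier A"
  proof (rule subring_of_sum [OF A], rule subring_of_mult [OF A const_in_A])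
    fix m assume "m \<in> Poly_Mapping.keys p"
    then have "wdeg w m = int n * int d" using p by (simp add: weighted_homogeneous_iff)
    then show "val_mono m * Poly_Mapping.single 0 (tt ^ n) \<in> carrier A"
      unfolding val_mono_T_power
      by (intro mono_xys_in_A [where c = "Poly_Mapping.lookup m Coord_s"])
        (simp add: wdeg_def algebra_simps)
  qed
  finally show "a \<in> carrier A" .
qed

text \<open>In the power d k all bounds imposed by the divisors are integers, attained by a monomial
  of the chart in x or y; what remains has no poles and is a polynomial in t.\<close>

lemma power_in_B_set:
  assumes f: "f \<in> dpd_piece Dp Dm i"
  shows "Poly_Mapping.single i f ^ (d * k) \<in> B_set"
proof (cases "f = 0")
  case True
  then show ?thesis using d k by (simp add: subring_of_0 [OF subring_of_B_set] power_0_left)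
next
  case f0: False
  show ?thesis
  proof (cases "i \<ge> 0")
    case True
    \<comment> \<open>The least order at 0 that D_+ allows for f^(d k). The matching element of the
      chart is x^(d k i) / z^(k i e_+).\<close>
    let ?j = "int k * i * ep"
    let ?g = "f ^ (d * k) * tt powi (- ?j)"
    have "0 \<le> order_at p ?g" for p
    proof -
      have "(if p = 0 then i * ep else 0) \<le> int d * order_at p f"
        using f by (simp only: dpd_piece_nonneg_iff [OF f0 True])
      then have "int k * (if p = 0 then i * ep else 0) \<le> int k * (int d * order_at p f)"
        by (rule mult_left_mono) simp
      then show ?thesis
        using f0 by (simp add: order_at_mult order_at_power order_at_T_powi mult_ac split: if_splits)
    qed
    moreover have "?g \<noteq> 0" using f0 by simp
    ultimately obtain h where h: "?g = to_fract h" using to_fract_of_order_at_nonneg by blast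
    have "f ^ (d * k) = tt powi ?j * to_fract h"
      unfolding h [symmetric] by (simp add: power_int_minus field_simps)
    then have "Poly_Mapping.single i f ^ (d * k) =
        mono_xys (nat (int d * int k * i)) 0 ?j * Poly_Mapping.single 0 (to_fract h)"
      using True by (simp add: single_power mono_xys_def mult_single)
    moreover have "mono_xys (nat (int d * int k * i)) 0 ?j \<in> B_set"
      using True by (intro mono_xys_in_B_set [where c = 0]) simp
    ultimately show ?thesis by (simp add: subring_of_mult [OF subring_of_B_set] poly_in_B_set)
  next
    case False
    then have i: "i < 0" by simp
    let ?j = "int k * (- i) * em"
    \<comment> \<open>Chosen so that y^b carries u^(d k i). Its factor Q^b is precisely the divisor
      that D_0 demands of f^(d k) away from 0, and \<open>?j\<close> is the bound at 0.\<close>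
    define b where "b = d * nat (- i)"
    have b: "int b = - (int d * i)" using i by (simp add: b_def)
    let ?g = "f ^ (d * k) * tt powi (- ?j) * inverse (to_fract Q ^ b)"
    have "0 \<le> order_at p ?g" for p
    proof -
      have *: "- i * em \<le> int d * order_at 0 f"
        "p \<noteq> 0 \<Longrightarrow> - i * order_at p (to_fract Q) \<le> int k * order_at p f"
        using f unfolding dpd_piece_neg_iff [OF f0 i] by blast+
      have g: "order_at p ?g = int d * int k * order_at p f - (if p = 0 then ?j else 0) -
          int b * order_at p (to_fract Q)"
        using f0 Q by (simp add: order_at_mult order_at_power order_at_T_powi order_at_inverse)
      show ?thesis
      proof (cases "p = 0")
        case True
        then show ?thesis
          using mult_left_mono [OF *(1), of "int k"] unfolding g by (simp add: order_at_0_Q mult_ac)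
      next
        case False
        then show ?thesis
          using mult_left_mono [OF *(2) [OF False], of "int d"] unfolding g b by (simp add: mult_ac)
      qed
    qed
    moreover have "?g \<noteq> 0" using f0 Q by simp
    ultimately obtain h where h: "?g = to_fract h" using to_fract_of_order_at_nonneg by blast
    have "f ^ (d * k) = to_fract Q ^ b * tt powi ?j * to_fract h"
      using Q unfolding h [symmetric] by (simp add: power_int_minus field_simps)
    then have "Poly_Mapping.single i f ^ (d * k) =
        mono_xys 0 b ?j * Poly_Mapping.single 0 (to_fract h)"
      by (simp add: single_power mono_xys_def mult_single b mult_ac)
    moreover have "mono_xys 0 b ?j \<in> B_set"
      by (intro mono_xys_in_B_set [where c = 0]) (simp add: b)
    ultimately show ?thesis by (simp add: subring_of_mult [OF subring_of_B_set] poly_in_B_set)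
  qed
qed

lemma to_fract_laurent_power: "to_fract (a ^ n :: laurent) = to_fract a ^ n"
  by (induction n) simp_all

lemma subring_of_to_fract_B_set: "subring_of (to_fract ` B_set)"
  using subring_of_B_set unfolding subring_of_def
  by (auto simp flip: to_fract_diff to_fract_mult to_fract_1)

text \<open>Each homogeneous component is a root of order d k of an element of \<open>B_set\<close>.
  The passage to \<open>laurent fract\<close> is due to sums of integral elements being treated over
  a field.\<close>

lemma integral_over_B_set:
  assumes a: "a \<in> carrier A"
  shows "integral_over (to_fract ` B_set) (to_fract a)"
proof -
  have "integral_over (to_fract ` B_set)
      (\<Sum>i \<in> Poly_Mapping.keys a. to_fract (Poly_Mapping.single i (Poly_Mapping.lookup a i)))"
  proof (intro integral_over_sum [OF subring_of_to_fract_B_set]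
      integral_over_root [OF subring_of_to_fract_B_set, of "d * k"])
    show "d * k > 0" using d k by simp
    fix i
    have "Poly_Mapping.lookup a i \<in> dpd_piece Dp Dm i" using a by (simp add: dpd_algebra_simps)
    then show "to_fract (Poly_Mapping.single i (Poly_Mapping.lookup a i)) ^ (d * k) \<in> to_fract ` B_set"
      using power_in_B_set by (simp flip: to_fract_laurent_power)
  qed
  then show ?thesis by (simp add: poly_mapping_sum_single flip: to_fract_sum)
qed

end

section \<open>The coordinate ring of the chart\<close>

context hypersurface
begin

section \<open>The hypersurface ring and its torus action\<close>

abbreviation (input) R where "R \<equiv> hypersurface_ring k F"
abbreviation (input) cls where "cls \<equiv> residue_class k F"
abbreviation (input) Z where "Z \<equiv> z_powers k F"
abbreviation (input) z :: poly_xyzs where "z \<equiv> coord_poly Coord_z"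

definition tau :: "complex \<Rightarrow> poly_xyzs \<Rightarrow> poly_xyzs" where
  "tau l = Poly_Mapping.mapp (\<lambda>m c.
     l powi (int (Poly_Mapping.lookup m Coord_x) - int k * int (Poly_Mapping.lookup m Coord_y)) * c)"

lemma xyzs_algebra_simps:
  "carrier (xyzs_algebra k) = UNIV" "p \<otimes>\<^bsub>xyzs_algebra k\<^esub> q = p * q" "p \<oplus>\<^bsub>xyzs_algebra k\<^esub> q = p + q"
  "\<one>\<^bsub>xyzs_algebra k\<^esub> = 1" "\<zero>\<^bsub>xyzs_algebra k\<^esub> = 0"
  "scal (xyzs_algebra k) c = Poly_Mapping.single 0 c" "torus (xyzs_algebra k) = tau"
  by (simp_all add: xyzs_algebra_def ring.defs gm_algebra.defs ring_of_type_algebra_def tau_def fun_eq_iff)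

lemma mem_cls_iff: "q \<in> cls p \<longleftrightarrow> (\<exists>h. q = h * F + p)"
  by (auto simp: residue_class_def a_r_coset_def' cgenideal_def xyzs_algebra_simps)

lemma cls_eqI: "p - q = h * F \<Longrightarrow> cls p = cls q"
proof -
  have "x \<in> cls q'" if "x \<in> cls p'" "p' - q' = h' * F" for x p' q' h'
  proof -
    obtain h'' where "x = h'' * F + p'" using \<open>x \<in> cls p'\<close> unfolding mem_cls_iff by blast
    then have "x = (h'' + h') * F + q'" using \<open>p' - q' = h' * F\<close> by (simp add: algebra_simps)
    then show ?thesis unfolding mem_cls_iff by blast
  qed
  moreover assume "p - q = h * F"
  moreover from this have "q - p = (- h) * F" by (simp add: algebra_simps)
  ultimately show ?thesis by blast
qed

lemma self_in_cls: "p \<in> cls p"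
  unfolding mem_cls_iff by (rule exI [of _ 0]) simp

lemma carrier_R: "carrier R = range cls"
  by (auto simp: hypersurface_ring_def quotient_algebra_def ring.defs gm_algebra.defs FactRing_def
      A_RCOSETS_def' residue_class_def xyzs_algebra_simps)

lemma cls_mult: "cls p \<otimes>\<^bsub>R\<^esub> cls q = cls (p * q)"
proof -
  have "cls (a * b) = cls (p * q)" if "a \<in> cls p" "b \<in> cls q" for a b
  proof -
    obtain g h where "a = g * F + p" "b = h * F + q"
      using \<open>a \<in> _\<close> \<open>b \<in> _\<close> unfolding mem_cls_iff by blast
    then show ?thesis by (intro cls_eqI [of _ _ "g * h * F + g * q + p * h"]) (simp add: algebra_simps)
  qed
  then have "(\<Union>a \<in> cls p. \<Union>b \<in> cls q. cls (a * b)) = cls (p * q)"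
    using self_in_cls [of p] self_in_cls [of q] by blast
  then show ?thesis
    by (simp add: hypersurface_ring_def quotient_algebra_def ring.defs gm_algebra.defs FactRing_def
        rcoset_mult_def residue_class_def xyzs_algebra_simps)
qed

lemma cls_add: "cls p \<oplus>\<^bsub>R\<^esub> cls q = cls (p + q)"
proof -
  have "(\<Union>a \<in> cls p. \<Union>b \<in> cls q. {a + b}) = cls (p + q)"
  proof (intro subset_antisym subsetI)
    fix x assume "x \<in> (\<Union>a \<in> cls p. \<Union>b \<in> cls q. {a + b})"
    then obtain g h where "x = (g * F + p) + (h * F + q)" unfolding mem_cls_iff by (auto simp: mem_cls_iff)
    then have "x = (g + h) * F + (p + q)" by (simp add: algebra_simps)
    then show "x \<in> cls (p + q)" unfolding mem_cls_iff by blast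
  next
    fix x assume "x \<in> cls (p + q)"
    then obtain h where "x = (h * F + p) + q" unfolding mem_cls_iff by (auto simp: add.assoc)
    moreover have "h * F + p \<in> cls p" unfolding mem_cls_iff by blast
    ultimately show "x \<in> (\<Union>a \<in> cls p. \<Union>b \<in> cls q. {a + b})" using self_in_cls [of q] by blast
  qed
  then show ?thesis
    by (simp add: hypersurface_ring_def quotient_algebra_def ring.defs gm_algebra.defs FactRing_def
        set_add_def' residue_class_def xyzs_algebra_simps)
qed

lemma cls_one: "\<one>\<^bsub>R\<^esub> = cls 1"
  by (simp add: hypersurface_ring_def quotient_algebra_def ring.defs gm_algebra.defs FactRing_def
      residue_class_def xyzs_algebra_simps)

lemma cls_zero: "\<zero>\<^bsub>R\<^esub> = cls 0"
proof -
  have "\<zero>\<^bsub>R\<^esub> = PIdl\<^bsub>xyzs_algebra k\<^esub> F"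
    by (simp add: hypersurface_ring_def quotient_algebra_def ring.defs gm_algebra.defs FactRing_def)
  then show ?thesis by (auto simp: mem_cls_iff cgenideal_def xyzs_algebra_simps)
qed

lemma cls_scal: "scal R c = cls (Poly_Mapping.single 0 c)"
  by (simp add: hypersurface_ring_def quotient_algebra_def ring.defs gm_algebra.defs
      residue_class_def xyzs_algebra_simps)

lemma cring_R: "cring R"
proof (intro cringI abelian_groupI comm_monoidI)
  fix x assume "x \<in> carrier R"
  then obtain p where "x = cls p" unfolding carrier_R by blast
  then have "cls (- p) \<oplus>\<^bsub>R\<^esub> x = \<zero>\<^bsub>R\<^esub>" by (simp add: cls_add cls_zero)
  then show "\<exists>y \<in> carrier R. y \<oplus>\<^bsub>R\<^esub> x = \<zero>\<^bsub>R\<^esub>" unfolding carrier_R by blast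
qed (auto simp: carrier_R cls_mult cls_add cls_one cls_zero algebra_simps)

lemma cls_power: "cls p [^]\<^bsub>R\<^esub> (n :: nat) = cls (p ^ n)"
proof -
  interpret R: cring R by (rule cring_R)
  show ?thesis by (induction n) (simp_all add: cls_one cls_mult mult.commute)
qed

lemma Z_eq: "Z = {cls (z ^ n) | n. True}"
  by (simp add: z_powers_def cls_power)

sublocale L: mult_closed_set "hypersurface_ring k F" "z_powers k F"
proof (intro mult_closed_set.intro cring_R mult_closed_set_axioms.intro)
  show "\<one>\<^bsub>R\<^esub> \<in> Z" unfolding Z_eq cls_one by (metis (mono_tags, lifting) mem_Collect_eq power_0)
  fix s t assume "s \<in> Z" "t \<in> Z"
  then obtain m n where st: "s = cls (z ^ m)" "t = cls (z ^ n)" unfolding Z_eq by blast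
  then have "s \<otimes>\<^bsub>R\<^esub> t = cls (z ^ (m + n))" by (simp add: cls_mult power_add)
  then show "s \<otimes>\<^bsub>R\<^esub> t \<in> Z" unfolding Z_eq by blast
qed (auto simp: Z_eq carrier_R)

lemma cls_in_R: "cls p \<in> carrier R"
  by (simp add: carrier_R)

lemma z_power_in_Z: "cls (z ^ n) \<in> Z"
  unfolding Z_eq by blast

lemma lookup_tau:
  "Poly_Mapping.lookup (tau l p) m = l powi (int (Poly_Mapping.lookup m Coord_x) -
     int k * int (Poly_Mapping.lookup m Coord_y)) * Poly_Mapping.lookup p m"
  unfolding tau_def by (rule lookup_mapp_mult)

lemma keys_tau: "Poly_Mapping.keys (tau l p) \<subseteq> Poly_Mapping.keys p"
  unfolding tau_def by (rule keys_mapp_subset)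

lemma tau_hom:
  assumes "l \<noteq> 0"
  shows tau_add: "tau l (p + q) = tau l p + tau l q"
    and tau_mult: "tau l (p * q) = tau l p * tau l q"
proof -
  have "l powi (int (Poly_Mapping.lookup (m + n) Coord_x) - int k * int (Poly_Mapping.lookup (m + n) Coord_y)) =
    l powi (int (Poly_Mapping.lookup m Coord_x) - int k * int (Poly_Mapping.lookup m Coord_y)) *
    l powi (int (Poly_Mapping.lookup n Coord_x) - int k * int (Poly_Mapping.lookup n Coord_y))"
    for m n :: "coord \<Rightarrow>\<^sub>0 nat"
    using assms by (subst power_int_add [symmetric]) (auto simp: lookup_add algebra_simps)
  note char = this
  show "tau l (p + q) = tau l p + tau l q" "tau l (p * q) = tau l p * tau l q"
    unfolding tau_def
    by (rule mapp_character_add mapp_character_mult; simp only: char lookup_zero; simp)+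
qed

text \<open>The torus scales monomials by the weights (1, -k, 0, 0). Weight 0 holds for F, because
  of x^k y, and for powers of z, so the action descends to R and to its localization.\<close>

lemma tau_invariant:
  assumes "weighted_homogeneous (\<lambda>v. case v of Coord_x \<Rightarrow> 1 | Coord_y \<Rightarrow> - int k | _ \<Rightarrow> 0) 0 p"
  shows "tau l p = p"
proof (rule poly_mapping_eqI)
  fix m
  show "Poly_Mapping.lookup (tau l p) m = Poly_Mapping.lookup p m"
  proof (cases "m \<in> Poly_Mapping.keys p")
    case True
    then have "int (Poly_Mapping.lookup m Coord_x) - int k * int (Poly_Mapping.lookup m Coord_y) = 0"
      using assms by (auto simp: weighted_homogeneous_iff wdeg_def)
    then show ?thesis by (simp add: lookup_tau)
  qed (simp add: lookup_tau in_keys_iff)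
qed

lemma tau_F: "tau l F = F"
proof (rule tau_invariant)
  let ?u = "\<lambda>v. case v of Coord_x \<Rightarrow> 1 | Coord_y \<Rightarrow> - int k | _ \<Rightarrow> 0"
  have "weighted_homogeneous ?u (int k * ?u Coord_x + ?u Coord_y) (coord_poly Coord_x ^ k * coord_poly Coord_y)"
    by (intro weighted_homogeneous_mult weighted_homogeneous_power weighted_homogeneous_coord)
  then show "weighted_homogeneous ?u 0 F"
    unfolding F_def hypersurface_poly_def
    by (intro weighted_homogeneous_diff weighted_homogeneous_s_homog_poly) simp_all
qed

lemma tau_z_power: "tau l (z ^ n) = z ^ n"
proof (rule tau_invariant)
  let ?u = "\<lambda>v. case v of Coord_x \<Rightarrow> 1 | Coord_y \<Rightarrow> - int k | _ \<Rightarrow> 0"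
  have "weighted_homogeneous ?u (int n * ?u Coord_z) (z ^ n)"
    by (intro weighted_homogeneous_power weighted_homogeneous_coord)
  then show "weighted_homogeneous ?u 0 (z ^ n)" by simp
qed

text \<open>The exponent of u in the image of a monomial is exactly its torus weight.\<close>

lemma eval_at_tau:
  assumes "l \<noteq> 0"
  shows "eval_at (tau l p) = torus_laurent l (eval_at p)"
proof -
  have "eval_at (tau l p) = (\<Sum>m \<in> Poly_Mapping.keys p.
      Poly_Mapping.single 0 (to_fract [:Poly_Mapping.lookup (tau l p) m:]) * val_mono m)"
    by (rule eval_at_superset) (simp_all add: keys_tau)
  also have "\<dots> = (\<Sum>m \<in> Poly_Mapping.keys p. torus_laurent l
      (Poly_Mapping.single 0 (to_fract [:Poly_Mapping.lookup p m:]) * val_mono m))"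
    by (intro sum.cong)
      (simp_all only: lookup_tau val_mono_def mult_single torus_laurent_single to_fract_const mult.assoc add_0)
  also have "\<dots> = torus_laurent l (eval_at p)"
    unfolding eval_at_def by (rule torus_laurent_sum [OF assms, symmetric])
  finally show ?thesis .
qed

lemma cls_torus:
  assumes "l \<noteq> 0"
  shows "torus R l (cls p) = cls (tau l p)"
proof -
  have "cls (tau l a) = cls (tau l p)" if "a \<in> cls p" for a
  proof -
    obtain h where "a = h * F + p" using \<open>a \<in> cls p\<close> unfolding mem_cls_iff by blast
    then have "tau l a = tau l h * F + tau l p" by (simp add: tau_add tau_mult assms tau_F)
    then show ?thesis by (intro cls_eqI [of _ _ "tau l h"]) simp
  qed
  then have "(\<Union>a \<in> cls p. cls (tau l a)) = cls (tau l p)" using self_in_cls [of p] by blast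
  then show ?thesis
    by (simp add: hypersurface_ring_def quotient_algebra_def ring.defs gm_algebra.defs
        residue_class_def xyzs_algebra_simps)
qed

lemma torus_R_hom:
  assumes "l \<noteq> 0"
  shows "torus R l \<in> Ring.ring_hom R R"
proof (rule ring_hom_memI)
  show "torus R l \<one>\<^bsub>R\<^esub> = \<one>\<^bsub>R\<^esub>"
    using tau_z_power [of l 0] by (simp add: cls_one cls_torus assms)
qed (auto simp: carrier_R cls_torus cls_mult cls_add tau_add tau_mult assms)

section \<open>The degree 0 part of R[1/z]\<close>

abbreviation (input) D where "D \<equiv> D_plus_z k w F"

definition fr :: "poly_xyzs \<Rightarrow> nat \<Rightarrow> (poly_xyzs set \<times> poly_xyzs set) set" where
  "fr p n = frac R Z (cls p) (cls (z ^ n))"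

lemma carrier_D: "carrier D = {fr p n | p n. weighted_homogeneous w (int n * int d) p}"
  by (simp add: D_plus_z_def fr_def cls_power)

lemma D_ops:
  "x \<otimes>\<^bsub>D\<^esub> y = x \<otimes>\<^bsub>localization R Z\<^esub> y" "x \<oplus>\<^bsub>D\<^esub> y = x \<oplus>\<^bsub>localization R Z\<^esub> y"
  "\<one>\<^bsub>D\<^esub> = fr 1 0" "\<zero>\<^bsub>D\<^esub> = fr 0 0" "torus D = torus (localization R Z)"
  "scal D c = fr (Poly_Mapping.single 0 c) 0"
  by (simp_all add: D_plus_z_def localization_def fr_def cls_one cls_zero cls_scal)

lemma fr_mult: "fr p n \<otimes>\<^bsub>D\<^esub> fr q m = fr (p * q) (n + m)"
  by (simp add: D_ops fr_def L.frac_mult cls_in_R z_power_in_Z cls_mult power_add)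

lemma fr_add: "fr p n \<oplus>\<^bsub>D\<^esub> fr q m = fr (p * z ^ m + q * z ^ n) (n + m)"
  by (simp add: D_ops fr_def L.frac_add cls_in_R z_power_in_Z cls_mult cls_add power_add)

lemma fr_torus:
  assumes "l \<noteq> 0"
  shows "torus D l (fr p n) = fr (tau l p) n"
proof -
  have "torus (localization R Z) l (frac R Z (cls p) (cls (z ^ n))) =
      frac R Z (torus R l (cls p)) (torus R l (cls (z ^ n)))"
    by (rule L.frac_torus [OF torus_R_hom [OF assms]])
      (auto simp: Z_eq cls_torus assms tau_z_power cls_in_R)
  then show ?thesis by (simp add: D_ops fr_def cls_torus assms tau_z_power)
qed

text \<open>The evaluation on residue classes, through a chosen representative; it is well defined
  because F goes to 0.\<close>

definition ev :: "poly_xyzs set \<Rightarrow> laurent" where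
  "ev C = eval_at (SOME p. p \<in> C)"

lemma ev_cls: "ev (cls p) = eval_at p"
proof -
  have "(SOME q. q \<in> cls p) \<in> cls p" using self_in_cls by (rule someI)
  then obtain h where "(SOME q. q \<in> cls p) = h * F + p" unfolding mem_cls_iff by blast
  then show ?thesis by (simp add: ev_def eval_at_add eval_at_mult eval_at_F)
qed

definition gD :: "(poly_xyzs set \<times> poly_xyzs set) set \<Rightarrow> laurent fract" where
  "gD U = (case SOME x. x \<in> U of (a, s) \<Rightarrow> to_fract (ev a) / to_fract (ev s))"

lemma eval_at_z_power_nonzero: "eval_at (z ^ n) \<noteq> 0"
  using eval_at_z_power_inverse [of n] by auto

lemma gD_fr: "gD (fr p n) = to_fract (eval_at p * Poly_Mapping.single 0 (tt ^ n))"
proof -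
  have "(SOME x. x \<in> fr p n) \<in> fr p n"
    using L.frac_self [OF cls_in_R z_power_in_Z] unfolding fr_def by (rule someI)
  \<comment> \<open>The chosen pair ranges over the class in the whole localization, so its
    numerator may be inhomogeneous. This does no harm: only nonvanishing of the images of powers of
    z is used.\<close>
  then obtain b t u where bt: "(SOME x. x \<in> fr p n) = (b, t)" "b \<in> carrier R" "t \<in> Z" "u \<in> Z"
    "u \<otimes>\<^bsub>R\<^esub> (cls p \<otimes>\<^bsub>R\<^esub> t) = u \<otimes>\<^bsub>R\<^esub> (b \<otimes>\<^bsub>R\<^esub> cls (z ^ n))"
    by (cases "SOME x. x \<in> fr p n") (auto simp: fr_def L.mem_frac_iff)
  then obtain q m r where q: "b = cls q" "t = cls (z ^ m)" "u = cls (z ^ r)"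
    unfolding carrier_R Z_eq by blast
  have "cls (z ^ r * (p * z ^ m)) = cls (z ^ r * (q * z ^ n))"
    using bt(5) by (simp add: q cls_mult)
  then have "ev (cls (z ^ r * (p * z ^ m))) = ev (cls (z ^ r * (q * z ^ n)))" by simp
  then have eq: "eval_at p * eval_at (z ^ m) = eval_at q * eval_at (z ^ n)"
    using eval_at_z_power_nonzero [of r] by (simp add: ev_cls eval_at_mult)
  have "gD (fr p n) = to_fract (eval_at q) / to_fract (eval_at (z ^ m))"
    by (simp add: gD_def bt(1) q ev_cls)
  also have "\<dots> = to_fract (eval_at p) / to_fract (eval_at (z ^ n))"
  proof -
    have "to_fract (eval_at p) * to_fract (eval_at (z ^ m)) =
        to_fract (eval_at q) * to_fract (eval_at (z ^ n))"
      using arg_cong [OF eq, of to_fract] by simp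
    then show ?thesis by (simp add: field_simps eval_at_z_power_nonzero)
  qed
  also have "\<dots> = to_fract (eval_at p * Poly_Mapping.single 0 (tt ^ n))"
  proof -
    have "to_fract (eval_at (z ^ n)) * to_fract (Poly_Mapping.single 0 (tt ^ n)) = 1"
      by (simp only: to_fract_mult [symmetric] eval_at_z_power_inverse to_fract_1)
    then show ?thesis by (simp add: field_simps eval_at_z_power_nonzero)
  qed
  finally show ?thesis .
qed

text \<open>Injectivity on the chart. The cross difference of the fractions is homogeneous and
  evaluates to 0, so \<open>eval_at_kernel\<close> makes it a multiple of F; no further power of z
  is required as a witness.\<close>

lemma fr_eqI:
  assumes p: "weighted_homogeneous w (int n * int d) p" and q: "weighted_homogeneous w (int m * int d) q"
    and eq: "eval_at p * Poly_Mapping.single 0 (tt ^ n) = eval_at q * Poly_Mapping.single 0 (tt ^ m)"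
  shows "fr p n = fr q m"
proof -
  let ?r = "p * z ^ m - q * z ^ n"
  have "weighted_homogeneous w (int (n + m) * int d) ?r"
    using weighted_homogeneous_mult [OF p weighted_homogeneous_z_power [of m]]
      weighted_homogeneous_mult [OF q weighted_homogeneous_z_power [of n]]
    by (intro weighted_homogeneous_diff) (simp_all add: algebra_simps)
  moreover have "eval_at ?r * Poly_Mapping.single 0 (tt ^ (n + m)) = 0"
    unfolding B_set_diff_aux using eq by simp
  then have "eval_at ?r * (eval_at (z ^ (n + m)) * Poly_Mapping.single 0 (tt ^ (n + m))) = 0"
    by (simp add: mult.left_commute)
  then have "eval_at ?r = 0" by (simp only: eval_at_z_power_inverse mult_1_right)
  ultimately obtain h where "?r = h * F" using eval_at_kernel by blast
  then have "cls (p * z ^ m) = cls (q * z ^ n)" by (rule cls_eqI)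
  then show ?thesis
    unfolding fr_def
    by (intro L.frac_eqI [OF cls_in_R cls_in_R z_power_in_Z z_power_in_Z L.S_one])
      (simp add: cls_mult)
qed

lemma gD_image: "gD ` carrier D = to_fract ` B_set"
proof -
  have "gD ` carrier D = {gD (fr p n) | p n. weighted_homogeneous w (int n * int d) p}"
    unfolding carrier_D by blast
  also have "\<dots> = to_fract ` B_set" unfolding B_set_def gD_fr by blast
  finally show ?thesis .
qed

text \<open>That the chart is a domain is a consequence of the embedding in a field, without
  recourse to irreducibility of F.\<close>

lemma D_embedding: "ring_embedding D gD"
proof -
  have inj: "inj_on gD (carrier D)"
  proof (rule inj_onI)
    fix x y assume *: "x \<in> carrier D" "y \<in> carrier D" "gD x = gD y"
    obtain p n q m where "x = fr p n" "weighted_homogeneous w (int n * int d) p"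
      "y = fr q m" "weighted_homogeneous w (int m * int d) q"
      using *(1,2) unfolding carrier_D by blast
    then show "x = y" using *(3) fr_eqI [of n p m q] by (simp only: gD_fr to_fract_eq_iff)
  qed
  have one: "\<one>\<^bsub>D\<^esub> \<in> carrier D" and zero: "\<zero>\<^bsub>D\<^esub> \<in> carrier D"
    using weighted_homogeneous_const [of w 1] weighted_homogeneous_const [of w 0]
    by (auto simp: D_ops carrier_D intro!: exI [of _ "0 :: nat"])
  have hom01: "gD \<one>\<^bsub>D\<^esub> = 1" "gD \<zero>\<^bsub>D\<^esub> = 0"
    by (simp_all add: D_ops gD_fr eval_at_1 eval_at_0)
  have ops: "x \<otimes>\<^bsub>D\<^esub> y \<in> carrier D \<and> gD (x \<otimes>\<^bsub>D\<^esub> y) = gD x * gD y"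
    "x \<oplus>\<^bsub>D\<^esub> y \<in> carrier D \<and> gD (x \<oplus>\<^bsub>D\<^esub> y) = gD x + gD y"
    if xy: "x \<in> carrier D" "y \<in> carrier D" for x y
  proof -
    obtain p n q m where x: "x = fr p n" "weighted_homogeneous w (int n * int d) p"
      and y: "y = fr q m" "weighted_homogeneous w (int m * int d) q"
      using xy unfolding carrier_D by blast
    have deg: "int n * int d + int m * int d = int (n + m) * int d" by (simp add: algebra_simps)
    have "weighted_homogeneous w (int (n + m) * int d) (p * q)"
      using weighted_homogeneous_mult [OF x(2) y(2)] by (simp only: deg)
    then have "x \<otimes>\<^bsub>D\<^esub> y \<in> carrier D" unfolding x y fr_mult carrier_D by blast
    moreover have "gD (x \<otimes>\<^bsub>D\<^esub> y) = gD x * gD y"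
    proof -
      have "Poly_Mapping.single 0 (tt ^ (n + m)) =
          (Poly_Mapping.single 0 (tt ^ n) * Poly_Mapping.single 0 (tt ^ m) :: laurent)"
        by (simp add: mult_single power_add)
      then show ?thesis unfolding x y fr_mult gD_fr by (simp add: eval_at_mult mult_ac)
    qed
    ultimately show "x \<otimes>\<^bsub>D\<^esub> y \<in> carrier D \<and> gD (x \<otimes>\<^bsub>D\<^esub> y) = gD x * gD y" by simp
    have neg: "weighted_homogeneous w (int m * int d) (- q)"
      using y(2) weighted_homogeneous_diff [of w _ 0 q] by (simp add: weighted_homogeneous_iff)
    have "weighted_homogeneous w (int (n + m) * int d) (p * z ^ m - (- q) * z ^ n)"
      using weighted_homogeneous_mult [OF x(2) weighted_homogeneous_z_power [of m]]
        weighted_homogeneous_mult [OF neg weighted_homogeneous_z_power [of n]]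
      by (intro weighted_homogeneous_diff) (simp_all add: algebra_simps)
    then have "weighted_homogeneous w (int (n + m) * int d) (p * z ^ m + q * z ^ n)" by simp
    then have "x \<oplus>\<^bsub>D\<^esub> y \<in> carrier D" unfolding x y fr_add carrier_D by blast
    moreover have "gD (x \<oplus>\<^bsub>D\<^esub> y) = gD x + gD y"
      using B_set_diff_aux [of p m "- q" n] unfolding x y fr_add gD_fr
      by (simp add: eval_at_uminus flip: to_fract_add to_fract_mult)
    ultimately show "x \<oplus>\<^bsub>D\<^esub> y \<in> carrier D \<and> gD (x \<oplus>\<^bsub>D\<^esub> y) = gD x + gD y" by simp
  qed
  have neg: "\<exists>y \<in> carrier D. gD y = - gD x" if "x \<in> carrier D" for x
  proof -
    have "gD x \<in> to_fract ` B_set" using that gD_image by blast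
    then have "- gD x \<in> gD ` carrier D"
      unfolding gD_image by (rule subring_of_uminus [OF subring_of_to_fract_B_set])
    then show ?thesis by (elim imageE) auto
  qed
  show ?thesis
    by (intro ring_embedding.intro ring_embedding_axioms.intro domainI_embedding [where g = gD]
        inj one zero neg hom01) (use ops in auto)
qed

lemma gD_torus:
  assumes "l \<noteq> 0" "x \<in> carrier D" "gD x = to_fract b"
  shows "torus D l x \<in> carrier D" "gD (torus D l x) = to_fract (torus_laurent l b)"
proof -
  obtain p n where x: "x = fr p n" "weighted_homogeneous w (int n * int d) p"
    using assms(2) unfolding carrier_D by blast
  have "weighted_homogeneous w (int n * int d) (tau l p)"
    using x(2) keys_tau [of l p] unfolding weighted_homogeneous_iff by blast
  then show "torus D l x \<in> carrier D" unfolding x fr_torus [OF assms(1)] carrier_D by blast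
  have b: "b = eval_at p * Poly_Mapping.single 0 (tt ^ n)"
    using assms(3) unfolding x gD_fr to_fract_eq_iff by simp
  show "gD (torus D l x) = to_fract (torus_laurent l b)"
    unfolding x fr_torus [OF assms(1)] gD_fr b
    using assms(1) by (simp add: eval_at_tau torus_laurent_mult torus_laurent_single to_fract_const)
qed

lemma gD_in_laurent: "x \<in> carrier D \<Longrightarrow> \<exists>b. gD x = to_fract b"
  using gD_image by blast

text \<open>The action multiplies each component by a nonzero constant, which leaves its divisor
  unchanged.\<close>

lemma torus_laurent_in_A:
  assumes "l \<noteq> 0" "a \<in> carrier A"
  shows "torus_laurent l a \<in> carrier A"
proof -
  have "to_fract [:c:] * f \<in> dpd_piece Dp Dm i" if "f \<in> dpd_piece Dp Dm i" "c \<noteq> 0" for f i and c :: complex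
  proof (cases "f = 0")
    case False
    then have "princ_div (to_fract [:c:] * f) = princ_div f"
      using that(2) by (intro poly_mapping_eqI) (simp add: lookup_princ_div order_at_mult order_at_const)
    then show ?thesis using that False by (simp add: dpd_piece_def)
  qed (simp add: zero_in_dpd_piece)
  then show ?thesis using assms by (simp add: dpd_algebra_simps lookup_torus_laurent)
qed

lemma equivariantly_isomorphic_dpd_algebra:
  assumes domain: "domain A"
    and normal: "integral_closure (total_fractions A) (fractions_image A) = fractions_image A"
  shows "equivariantly_isomorphic A (normalization D)"
proof (rule equivariantly_isomorphic_normalizationI [where gA = to_fract and gB = gD])
  interpret D: ring_embedding D gD by (rule D_embedding)
  show "ring_embedding D gD" by (rule D_embedding)
  show emb: "ring_embedding A to_fract"
    by (intro ring_embedding.intro domain ring_embedding_axioms.intro)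
      (simp_all add: inj_on_def dpd_algebra_simps(2-5))
  have "subring_of (carrier A)"
  proof -
    interpret A: domain A by (rule domain)
    have "a - b \<in> carrier A" if "a \<in> carrier A" "b \<in> carrier A" for a b
    proof -
      \<comment> \<open>Closure of A under sums and products comes from its being a domain;
        differences taken in the type are reached through multiplication by the constant -1 in
        A.\<close>
      have "[:- 1:] = (- 1 :: complex poly)" by (simp add: one_pCons)
      then have "Poly_Mapping.single 0 (to_fract [:- 1:]) = (- 1 :: laurent)"
        by (simp add: single_uminus)
      then have "- 1 \<in> carrier A" using const_in_A [of "- 1"] by simp
      then have "a \<oplus>\<^bsub>A\<^esub> ((- 1) \<otimes>\<^bsub>A\<^esub> b) \<in> carrier A" using that by (intro A.a_closed A.m_closed)
      then show ?thesis by (simp add: dpd_algebra_simps(2,3))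
    qed
    then show ?thesis
      unfolding subring_of_def using A.one_closed A.m_closed by (auto simp: dpd_algebra_simps(2-4))
  qed
  then show "gD ` carrier D \<subseteq> to_fract ` carrier A" unfolding gD_image using B_set_subset by blast
  show "integral_over (gD ` carrier D) (to_fract a)" if "a \<in> carrier A" for a
    unfolding gD_image using that by (rule integral_over_B_set)
  show "\<exists>b \<in> carrier D. \<exists>s \<in> carrier D. gD s \<noteq> 0 \<and> to_fract a * gD s = gD b" for a
  proof -
    obtain s where s: "s \<in> B_set" "s \<noteq> 0" "a * s \<in> B_set" using quotient_of_B_set by blast
    then have "to_fract s \<in> gD ` carrier D" "to_fract (a * s) \<in> gD ` carrier D"
      unfolding gD_image using s by (simp_all only: imageI)
    then obtain t b where tb: "t \<in> carrier D" "to_fract s = gD t" "b \<in> carrier D" "to_fract (a * s) = gD b"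
      by (elim imageE)
    have "gD t \<noteq> 0 \<and> to_fract a * gD t = gD b"
      unfolding tb(2) [symmetric] tb(4) [symmetric] using s(2) by simp
    then show ?thesis using tb by blast
  qed
  show "torus A l a \<in> carrier A" if "l \<noteq> 0" "a \<in> carrier A" for l a
    using torus_laurent_in_A [OF that] by (simp only: dpd_algebra_simps)
  show "torus D l \<in> Ring.ring_hom D D" if l: "l \<noteq> 0" for l
  proof (rule ring_hom_memI)
    fix x y assume x: "x \<in> carrier D" and y: "y \<in> carrier D"
    show Tx: "torus D l x \<in> carrier D"
      using gD_in_laurent [OF x] gD_torus [OF l x] by blast
    have Ty: "torus D l y \<in> carrier D"
      using gD_in_laurent [OF y] gD_torus [OF l y] by blast
    obtain a b where ab: "gD x = to_fract a" "gD y = to_fract b"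
      using gD_in_laurent [OF x] gD_in_laurent [OF y] by blast
    have m: "x \<otimes>\<^bsub>D\<^esub> y \<in> carrier D" "gD (x \<otimes>\<^bsub>D\<^esub> y) = to_fract (a * b)"
      using x y by (simp_all add: D.g_mult ab)
    have s: "x \<oplus>\<^bsub>D\<^esub> y \<in> carrier D" "gD (x \<oplus>\<^bsub>D\<^esub> y) = to_fract (a + b)"
      using x y by (simp_all add: D.g_add ab)
    show "torus D l (x \<otimes>\<^bsub>D\<^esub> y) = torus D l x \<otimes>\<^bsub>D\<^esub> torus D l y"
      using gD_torus [OF l m] gD_torus [OF l x ab(1)] gD_torus [OF l y ab(2)]
      by (intro D.g_eq_iff [THEN iffD1]) (simp_all add: D.g_mult torus_laurent_mult l)
    show "torus D l (x \<oplus>\<^bsub>D\<^esub> y) = torus D l x \<oplus>\<^bsub>D\<^esub> torus D l y"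
      using gD_torus [OF l s] gD_torus [OF l x ab(1)] gD_torus [OF l y ab(2)]
      by (intro D.g_eq_iff [THEN iffD1]) (simp_all add: D.g_add torus_laurent_add l)
  next
    show "torus D l \<one>\<^bsub>D\<^esub> = \<one>\<^bsub>D\<^esub>"
      using tau_z_power [of l 0] by (simp add: D_ops(3) fr_torus l)
  qed
  show "x = \<zero>\<^bsub>D\<^esub>" if "l \<noteq> 0" "x \<in> carrier D" "torus D l x = \<zero>\<^bsub>D\<^esub>" for l x
  proof -
    obtain a where a: "gD x = to_fract a" using gD_in_laurent [OF \<open>x \<in> carrier D\<close>] by blast
    have "torus_laurent l a = 0"
      using gD_torus(2) [OF that(1,2) a] that(3) by (simp add: D.g_zero)
    then have "gD x = 0" using torus_laurent_eq_0 [OF that(1)] by (simp add: a)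
    then show ?thesis using D.g_eq_0_iff [OF that(2)] by simp
  qed
  show "to_fract (torus A l a) * gD (torus D l s) = gD (torus D l b)"
    if "l \<noteq> 0" "a \<in> carrier A" "b \<in> carrier D" "s \<in> carrier D" "to_fract a * gD s = gD b" for l a b s
  proof -
    obtain s' where s': "gD s = to_fract s'" using gD_in_laurent [OF \<open>s \<in> carrier D\<close>] by blast
    then have b': "gD b = to_fract (a * s')" using that(5) by simp
    show ?thesis
      using gD_torus(2) [OF that(1,4) s'] gD_torus(2) [OF that(1,3) b']
      by (simp add: dpd_algebra_simps(7) torus_laurent_mult that(1))
  qed
  show "scal A c \<in> carrier A" for c using const_in_A by (simp only: dpd_algebra_simps(6))
  show "scal D c \<in> carrier D" for c
    using weighted_homogeneous_const [of w c] unfolding D_ops(6) carrier_D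
    by (auto intro!: exI [of _ "0 :: nat"])
  show "to_fract (scal A c) = gD (scal D c)" for c
    unfolding D_ops(6) dpd_algebra_simps(6) gD_fr by (simp add: eval_at_single v_0)
qed (rule normal)

end

theorem theorem2p3:
  fixes d k :: nat
    and ep em :: int
    and D0 :: "complex \<Rightarrow>\<^sub>0 int"
    and Dp Dm :: "complex \<Rightarrow>\<^sub>0 rat"
    and Q :: "complex poly"
  assumes "d \<ge> 1" and "k \<ge> 1"
    and "0 < ep" and "ep \<le> int d"
    and "Dp = Poly_Mapping.single 0 (- (of_int ep / of_nat d))"
    and "Dm = Poly_Mapping.single 0 (- (of_int em / of_nat d)) - scale_div (1 / of_nat k) (rat_div D0)"
    and "effective (- (Dp + Dm))"
    and "Poly_Mapping.lookup D0 0 = 0"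
    and "normal_affine_surface (dpd_algebra Dp Dm)"
    and "\<exists>\<sigma>. additive_group_action (dpd_algebra Dp Dm) \<sigma>"
    and "Q \<noteq> 0" and "D0 = princ_div (to_fract Q)"
  shows "equivariantly_isomorphic
           (dpd_algebra Dp Dm)
           (normalization (D_plus_z k (weight d k ep em Q) (hypersurface_poly d k ep em Q)))"
proof -
  \<comment> \<open>Since D_0(0) = 0, this coefficient is (e_+ + e_-) / d.\<close>
  have "0 \<le> Poly_Mapping.lookup (- (Dp + Dm)) 0"
    using assms(7) unfolding effective_def by blast
  then have "0 \<le> (of_int ep + of_int em :: rat) / of_nat d"
    using assms(5,6,8)
    by (simp add: lookup_add lookup_minus lookup_scale_div lookup_rat_div add_divide_distrib)
  then have "0 \<le> (of_int (ep + em) :: rat)"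
    using assms(1) by (simp add: zero_le_divide_iff)
  then have "0 \<le> ep + em" by (simp only: of_int_0_le_iff)
  \<comment> \<open>D_0(0) is the order of Q at 0, so its vanishing means that 0 is not a
    root.\<close>
  moreover have "poly Q 0 \<noteq> 0"
    using assms(8,11,12) by (simp add: lookup_princ_div order_at_to_fract Polynomial.order_eq_0_iff)
  ultimately interpret hypersurface d k ep em Q
    using assms by unfold_locales
  show ?thesis
    using equivariantly_isomorphic_dpd_algebra assms(5,6,9,12)
    unfolding normal_affine_surface_def F_def by simp
qed

end
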